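(* Let $a,b,c>1$ be integers with $\gcd(a,b)>1$, and suppose $(a,b,c)\in S_c\cup S_o\cup S_{aa}\cup S_{bb}$. Then $N(a,b,c)=2$, and the equation $a^x+b^y=c^z$ has two distinct solutions $(x_1,y_1,z_1)$ and $(x_2,y_2,z_2)$ such that the nine-tuple $(a,b,c,x_1,y_1,z_1,x_2,y_2,z_2)$ is in one of the infinite families (i), (ii), (iii), or (iv).
   Context: Equation and counting: for integers $a,b,c>1$ consider $a^x+b^y=c^z$ in positive integers $x,y,z$. $N(a,b,c)$ is the number of solutions, where two solutions $(x_1,y_1,z_1)$, $(x_2,y_2,z_2)$ are considered the same if $\{a^{x_1},b^{y_1}\}=\{a^{x_2},b^{y_2}\}$. Two solutions are called distinct if they differ as ordered triples. A solution $(x,y,z)$ for the triple $(a,b,c)$ corresponds to a solution $(X,Y,Z)$ for the triple $(A,B,C)$ (of the same equation with $A,B,C$ in place of $a,b,c$) if $\{a^x,b^y\}=\{A^X,B^Y\}$. Types: when $\gcd(a,b)>1$, let $Q$ be the set of primes dividing all of $a$, $b$, $c$; for $p\in Q$ let $p^{\alpha_p}\parallel a$, $p^{\beta_p}\parallel b$, $p^{\gamma_p}\parallel c$. A solution $(x,y,z)$ is Type A for $p$ if $\alpha_p x>\beta_p y=\gamma_p z$; Type B for $p$ if $\beta_p y>\alpha_p x=\gamma_p z$; Type C for $p$ if $\gamma_p z>\alpha_p x=\beta_p y$; Type O for $p$ if $\alpha_p x=\beta_p y=\gamma_p z$. Sets: $S_c$ is the set of triples $(a,b,c)$ with $\gcd(a,b)>1$,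 $N(a,b,c)>1$, $a,b,c$ not all powers of 2, and some solution that is Type C for some prime in $Q$. $S_o$ is the set of triples with $\gcd(a,b)>1$, $N(a,b,c)>1$, and some solution that is Type O for some prime in $Q$. $S_{aa}$ (resp. $S_{bb}$) is the set of triples with $\gcd(a,b)>1$ such that the equation has two distinct solutions both of which are Type A (resp. Type B) for some (common) prime in $Q$. Infinite families (all parameters are integers; a choice of parameters is allowable when it satisfies the stated constraints and all entries below are positive integers): (i) $(a,b,c)=(2,\,2^u(2^{h-1}-1),\,2^u(2^{h-1}+1))$, $(x_1,y_1,z_1)=(u+1,1,1)$, $(x_2,y_2,z_2)=(2u+h+1,2,2)$, with $u>0$, $h>1$. (ii) $(a,b,c)=(2\cdot 3^t,3,3)$, $(x_1,y_1,z_1)=(1,t,t+1)$, $(x_2,y_2,z_2)=(3,3t,3t+2)$, with $t>0$. (iii) $(a,b,c)=(g^j,\,g^{ju}d,\,g^{ju}(d+1))$, $(x_1,y_1,z_1)=(u,1,1)$, $(x_2,y_2,z_2)=(ku+\frac{w}{j},k,k)$, with $j>0$, $u>0$, $d>0$, $g>1$ odd, $(d+1)^k-d^k=g^w$, $w>0$, $k>1$. (iv) $(a,b,c)=(2^ig^j,\,2^{iu-1}g^{ju}d,\,2^{iu-1}g^{ju}(d+2))$, $(x_1,y_1,z_1)=(u,1,1)$, $(x_2,y_2,z_2)=(ku+\frac{w}{j},k,k)$, with $i>0$, $j>0$, $u>0$, $d>0$ odd, $g>1$ odd, $g^w$ the greatest odd divisor of $(d+2)^k-d^k$, $w>0$,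 $k>0$ even, and $k-v=h-\frac{iw}{j}$ where $2^h\parallel 2d+2$ and $2^v\parallel k$. For each family, let $F$ be the set of all nine-tuples $(a,b,c,x_1,y_1,z_1,x_2,y_2,z_2)$ obtained from allowable parameter choices. If $(x_1,y_1,z_1)$ and $(x_2,y_2,z_2)$ are distinct solutions for $(a,b,c)$, the nine-tuple $(a,b,c,x_1,y_1,z_1,x_2,y_2,z_2)$ is said to be in that family if there is $(A,B,C,X_1,Y_1,Z_1,X_2,Y_2,Z_2)\in F$ such that each of the solutions $(X_1,Y_1,Z_1)$, $(X_2,Y_2,Z_2)$ for $(A,B,C)$ corresponds to one of the solutions $(x_1,y_1,z_1)$, $(x_2,y_2,z_2)$ for $(a,b,c)$. *)

theory Defs
  imports Complex_Main "HOL-Library.Extended_Nat" "HOL-Computational_Algebra.Primes"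
begin

type_synonym triple = "nat \<times> nat \<times> nat"

fun is_solution :: "triple \<Rightarrow> triple \<Rightarrow> bool" where
  "is_solution (a, b, c) (x, y, z) \<longleftrightarrow> x > 0 \<and> y > 0 \<and> z > 0 \<and> a ^ x + b ^ y = c ^ z"

fun summands :: "triple \<Rightarrow> triple \<Rightarrow> nat set" where
  "summands (a, b, c) (x, y, z) = {a ^ x, b ^ y}"

definition same_solution_rel :: "triple \<Rightarrow> (triple \<times> triple) set" where
  "same_solution_rel t =
     {(s, s'). is_solution t s \<and> is_solution t s' \<and> summands t s = summands t s'}"

text \<open>The count is an extended natural number because it can be infinite:
  \<open>2 ^ n + 2 ^ n = 2 ^ (n + 1)\<close> for all \<open>n\<close>.\<close>

definition num_solutions :: "nat \<Rightarrow> nat \<Rightarrow> nat \<Rightarrow> enat" where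
  "num_solutions a b c =
     (let classes = {s. is_solution (a, b, c) s} // same_solution_rel (a, b, c)
      in if finite classes then enat (card classes) else \<infinity>)"

definition corresponds :: "triple \<Rightarrow> triple \<Rightarrow> triple \<Rightarrow> triple \<Rightarrow> bool" where
  "corresponds t s T S \<longleftrightarrow> is_solution t s \<and> is_solution T S \<and> summands t s = summands T S"

definition common_primes :: "triple \<Rightarrow> nat set" where
  "common_primes = (\<lambda>(a, b, c). {p. prime p \<and> p dvd a \<and> p dvd b \<and> p dvd c})"

fun type_A :: "nat \<Rightarrow> triple \<Rightarrow> triple \<Rightarrow> bool" where
  "type_A p (a, b, c) (x, y, z) \<longleftrightarrow>
     multiplicity p a * x > multiplicity p b * y \<and> multiplicity p b * y = multiplicity p c * z"

fun type_B :: "nat \<Rightarrow> triple \<Rightarrow> triple \<Rightarrow> bool" where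
  "type_B p (a, b, c) (x, y, z) \<longleftrightarrow>
     multiplicity p b * y > multiplicity p a * x \<and> multiplicity p a * x = multiplicity p c * z"

fun type_C :: "nat \<Rightarrow> triple \<Rightarrow> triple \<Rightarrow> bool" where
  "type_C p (a, b, c) (x, y, z) \<longleftrightarrow>
     multiplicity p c * z > multiplicity p a * x \<and> multiplicity p a * x = multiplicity p b * y"

fun type_O :: "nat \<Rightarrow> triple \<Rightarrow> triple \<Rightarrow> bool" where
  "type_O p (a, b, c) (x, y, z) \<longleftrightarrow>
     multiplicity p a * x = multiplicity p b * y \<and> multiplicity p b * y = multiplicity p c * z"

definition S_c :: "triple set" where
  "S_c = {(a, b, c). a > 1 \<and> b > 1 \<and> c > 1 \<and> gcd a b > 1 \<and> num_solutions a b c > 1 \<and>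
     \<not> (\<exists>i j k. a = 2 ^ i \<and> b = 2 ^ j \<and> c = 2 ^ k) \<and>
     (\<exists>s. is_solution (a, b, c) s \<and> (\<exists>p\<in>common_primes (a, b, c). type_C p (a, b, c) s))}"

definition S_o :: "triple set" where
  "S_o = {(a, b, c). a > 1 \<and> b > 1 \<and> c > 1 \<and> gcd a b > 1 \<and> num_solutions a b c > 1 \<and>
     (\<exists>s. is_solution (a, b, c) s \<and> (\<exists>p\<in>common_primes (a, b, c). type_O p (a, b, c) s))}"

definition S_aa :: "triple set" where
  "S_aa = {(a, b, c). a > 1 \<and> b > 1 \<and> c > 1 \<and> gcd a b > 1 \<and>
     (\<exists>s s'. s \<noteq> s' \<and> is_solution (a, b, c) s \<and> is_solution (a, b, c) s' \<and>
       (\<exists>p\<in>common_primes (a, b, c). type_A p (a, b, c) s \<and> type_A p (a, b, c) s'))}"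

definition S_bb :: "triple set" where
  "S_bb = {(a, b, c). a > 1 \<and> b > 1 \<and> c > 1 \<and> gcd a b > 1 \<and>
     (\<exists>s s'. s \<noteq> s' \<and> is_solution (a, b, c) s \<and> is_solution (a, b, c) s' \<and>
       (\<exists>p\<in>common_primes (a, b, c). type_B p (a, b, c) s \<and> type_B p (a, b, c) s'))}"

text \<open>Nine-tuples are grouped as \<open>((a, b, c), (x1, y1, z1), (x2, y2, z2))\<close>. The constraints force
  all parameters to be nonnegative, so they range over the natural numbers. The requirement that the
  exponent \<open>k * u + w / j\<close> be an integer is the condition \<open>j dvd w\<close>.\<close>

definition family_i :: "(triple \<times> triple \<times> triple) set" where
  "family_i =
    {((2, 2 ^ u * (2 ^ (h - 1) - 1), 2 ^ u * (2 ^ (h - 1) + 1)),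
      (u + 1, 1, 1), (2 * u + h + 1, 2, 2)) | u h. u > 0 \<and> h > 1}"

definition family_ii :: "(triple \<times> triple \<times> triple) set" where
  "family_ii =
    {((2 * 3 ^ t, 3, 3), (1, t, t + 1), (3, 3 * t, 3 * t + 2)) | t. t > 0}"

definition family_iii :: "(triple \<times> triple \<times> triple) set" where
  "family_iii =
    {((g ^ j, g ^ (j * u) * d, g ^ (j * u) * (d + 1)),
      (u, 1, 1), (k * u + w div j, k, k)) | g j u d k w.
      j > 0 \<and> u > 0 \<and> d > 0 \<and> g > 1 \<and> odd g \<and>
      (d + 1) ^ k - d ^ k = g ^ w \<and> w > 0 \<and> k > 1 \<and> j dvd w}"

definition family_iv :: "(triple \<times> triple \<times> triple) set" where
  "family_iv =
    {((2 ^ i * g ^ j, 2 ^ (i * u - 1) * g ^ (j * u) * d, 2 ^ (i * u - 1) * g ^ (j * u) * (d + 2)),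
      (u, 1, 1), (k * u + w div j, k, k)) | i g j u d k w.
      i > 0 \<and> j > 0 \<and> u > 0 \<and> d > 0 \<and> odd d \<and> g > 1 \<and> odd g \<and>
      g ^ w = Max {n. odd n \<and> n dvd (d + 2) ^ k - d ^ k} \<and> w > 0 \<and> k > 0 \<and> even k \<and> j dvd w \<and>
      real k - real (multiplicity 2 k) =
        real (multiplicity 2 (2 * d + 2)) - real i * real w / real j}"

definition in_family ::
  "(triple \<times> triple \<times> triple) set \<Rightarrow> triple \<times> triple \<times> triple \<Rightarrow> bool" where
  "in_family F = (\<lambda>(t, s1, s2).
     is_solution t s1 \<and> is_solution t s2 \<and> s1 \<noteq> s2 \<and>
     (\<exists>(T, S1, S2)\<in>F. \<forall>S\<in>{S1, S2}. \<exists>s\<in>{s1, s2}. corresponds t s T S))"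

end

theory Submission
  imports Defs "HOL-Number_Theory.Cong"
begin

text \<open>
  Fix a common prime \<open>p\<close>. Two solutions that are both of type A or O at \<open>p\<close> have proportional
  exponents \<open>(y, z)\<close>, so after removing common factors \<open>D ^ m * (f ^ m - e ^ m)\<close> and
  \<open>D ^ n * (f ^ n - e ^ n)\<close> are both powers of \<open>a\<close>, with \<open>m < n\<close> and \<open>e\<close>, \<open>f\<close> coprime. Comparing sizes
  gives \<open>n * v(f ^ m - e ^ m) < m * v(f ^ n - e ^ n)\<close> for the valuation \<open>v\<close> at every prime dividing
  \<open>a\<close>; lifting the exponent then leaves only \<open>m = 1\<close> and \<open>f - e = 1\<close> (family iii) or \<open>f - e = 2\<close>
  (families i and iv). Two solutions of type C or O have proportional \<open>(x, y)\<close>, and the same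
  argument for \<open>f ^ n + e ^ n\<close> leaves \<open>9 = 2 ^ 3 + 1\<close> (family ii) or powers of 2. A type C solution
  excludes types A and B by size alone. A third solution must therefore be of the mixed type A/B,
  which reduces to elementary equations between powers of 2 and numbers \<open>2 ^ H \<plusminus> 1\<close>.
\<close>

section \<open>Lifting the exponent\<close>

text \<open>Write \<alpha>, \<beta>, \<gamma> for the valuations of \<open>a\<close>,
  \<open>b\<close>, \<open>c\<close> at \<open>p\<close>. Types A and O share
  \<open>\<beta> * y = \<gamma> * z\<close>, types C and O share
  \<open>\<alpha> * x = \<beta> * y\<close>; this is what fixes an exponent ratio. The obstacle is
  the common factor \<open>D\<close>, whose valuations are unknown. Subtracting \<open>m\<close>
  times the second valuation identity from \<open>n\<close> times the first removes it and leaves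
  \<open>n * x - m * x'\<close>, and the sign of this is known at all primes at once from a
  comparison of real sizes. Against it stands the slow growth of v(f^n - e^n): lifting adds only
  v(n) < n. The prime 2 escapes when \<open>n\<close> is even and \<open>f - e\<close> is twice an
  odd number, and this exception is why a gap of 2 survives. For sums the size comparison is
  reversed, because the n-th root of \<open>f ^ n + e ^ n\<close> decreases in \<open>n\<close>;
  there \<open>f ^ n + e ^ n\<close> must divide \<open>(f + e) * n\<close>, which is rarely
  possible. A type B solution has no ratio in common with a type A one, so their valuations at
  \<open>p\<close> are turned into inequalities between exponents, which can be tested at every
  other prime.\<close>

lemma prime_int_dvd_power: "prime p \<Longrightarrow> int p dvd e ^ n \<Longrightarrow> int p dvd e"
  by (rule prime_dvd_power) simp_all

lemma geometric_sum_cong: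
  fixes e f r :: int
  assumes "[f = e] (mod r)"
  shows "[(\<Sum>i<n. e ^ (n - Suc i) * f ^ i) = int n * e ^ (n - 1)] (mod r)"
proof -
  have "[(\<Sum>i<n. e ^ (n - Suc i) * f ^ i) = (\<Sum>i<n. e ^ (n - 1))] (mod r)"
  proof (rule cong_sum)
    fix i assume "i \<in> {..<n}"
    hence "n - 1 = (n - Suc i) + i" by auto
    hence "e ^ (n - 1) = e ^ (n - Suc i) * e ^ i" by (metis power_add)
    thus "[e ^ (n - Suc i) * f ^ i = e ^ (n - 1)] (mod r)"
      using assms by (simp add: cong_mult cong_pow)
  qed
  thus ?thesis by simp
qed

lemma power_add_multiple_cong:
  fixes e k r :: int
  shows "[(e + r * k) ^ i = e ^ i + int i * (r * k) * e ^ (i - 1)] (mod r ^ 2)"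
proof (induction i)
  case (Suc i)
  have "[(e + r * k) ^ Suc i = (e + r * k) * (e ^ i + int i * (r * k) * e ^ (i - 1))] (mod r ^ 2)"
    unfolding power_Suc using Suc by (intro cong_mult) auto
  also have "(e + r * k) * (e ^ i + int i * (r * k) * e ^ (i - 1)) =
      (e ^ Suc i + int (Suc i) * (r * k) * e ^ i) + r ^ 2 * (int i * k ^ 2 * e ^ (i - 1))"
    by (cases i) (simp_all add: algebra_simps power2_eq_square)
  also have "[\<dots> = e ^ Suc i + int (Suc i) * (r * k) * e ^ i] (mod r ^ 2)"
    by (simp add: cong_iff_dvd_diff)
  finally show ?case by simp
qed simp

lemma not_dvd_geometric_sum:
  fixes e f :: int
  assumes p: "prime p" and "int p dvd f - e" "\<not> int p dvd e" "\<not> p dvd n"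
  shows "\<not> int p dvd (\<Sum>i<n. e ^ (n - Suc i) * f ^ i)"
proof
  assume "int p dvd (\<Sum>i<n. e ^ (n - Suc i) * f ^ i)"
  moreover have "[(\<Sum>i<n. e ^ (n - Suc i) * f ^ i) = int n * e ^ (n - 1)] (mod (int p))"
    using assms by (intro geometric_sum_cong) (simp add: cong_iff_dvd_diff)
  ultimately have "int p dvd int n * e ^ (n - 1)" by (simp add: cong_dvd_iff)
  thus False using assms by (auto simp: prime_dvd_mult_iff dest: prime_int_dvd_power)
qed

text \<open>Put \<open>f = e + p * k\<close> and work modulo \<open>p ^ 2\<close>: each term is
  \<open>e ^ (p - 1)\<close> plus \<open>i\<close> times a fixed multiple of \<open>p\<close>. For
  odd \<open>p\<close> the sum of all \<open>i < p\<close> is again divisible by \<open>p\<close>,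
  so the linear part vanishes and \<open>p * e ^ (p - 1)\<close> remains.\<close>

lemma multiplicity_geometric_sum_prime:
  fixes e f :: int
  assumes p: "prime p" "odd p" and "int p dvd f - e" "\<not> int p dvd e"
  shows "multiplicity (int p) (\<Sum>i<p. e ^ (p - Suc i) * f ^ i) = 1"
proof -
  from assms obtain k where k: "f = e + int p * k" by (auto simp: dvd_def algebra_simps)
  let ?p = "int p"
  have p2: "p \<ge> 2" using p by (simp add: prime_ge_2_nat)
  have "[(\<Sum>i<p. e ^ (p - Suc i) * f ^ i) =
      (\<Sum>i<p. e ^ (p - 1) + int i * (?p * k * e ^ (p - 2)))] (mod ?p ^ 2)"
  proof (rule cong_sum)
    fix i assume i: "i \<in> {..<p}"
    have "[e ^ (p - Suc i) * f ^ i =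
        e ^ (p - Suc i) * (e ^ i + int i * (?p * k) * e ^ (i - 1))] (mod ?p ^ 2)"
      unfolding k by (intro cong_mult power_add_multiple_cong) auto
    also have "e ^ (p - Suc i) * (e ^ i + int i * (?p * k) * e ^ (i - 1)) =
        e ^ ((p - Suc i) + i) + int i * (?p * k) * e ^ ((p - Suc i) + (i - 1))"
      by (simp only: power_add algebra_simps)
    also have "\<dots> = e ^ (p - 1) + int i * (?p * k * e ^ (p - 2))"
    proof (cases i)
      case (Suc j)
      have "p - Suc i + i = p - 1" "p - Suc i + (i - 1) = p - 2" using i p2 Suc by auto
      thus ?thesis by (simp only: mult.assoc)
    qed simp
    finally show "[e ^ (p - Suc i) * f ^ i = e ^ (p - 1) + int i * (?p * k * e ^ (p - 2))] (mod ?p ^ 2)" .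
  qed
  also have "(\<Sum>i<p. e ^ (p - 1) + int i * (?p * k * e ^ (p - 2))) =
      ?p * e ^ (p - 1) + (\<Sum>i<p. int i) * (?p * k * e ^ (p - 2))"
    by (simp add: sum.distrib sum_distrib_right)
  also have "(\<Sum>i<p. int i) = ?p * ((?p - 1) div 2)"
  proof -
    have "2 * (\<Sum>i<n. int i) = int n * (int n - 1)" for n
      by (induction n) (auto simp: algebra_simps)
    from this[of p] show ?thesis using p by (auto elim!: oddE)
  qed
  also have "?p * e ^ (p - 1) + ?p * ((?p - 1) div 2) * (?p * k * e ^ (p - 2)) =
      ?p * e ^ (p - 1) + ?p ^ 2 * (((?p - 1) div 2) * k * e ^ (p - 2))"
    by (simp add: power2_eq_square algebra_simps)
  also have "[\<dots> = ?p * e ^ (p - 1)] (mod ?p ^ 2)"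
    by (simp add: cong_iff_dvd_diff)
  finally have c: "[(\<Sum>i<p. e ^ (p - Suc i) * f ^ i) = ?p * e ^ (p - 1)] (mod ?p ^ 2)" .
  show ?thesis
  proof (rule multiplicity_eqI)
    have "[(\<Sum>i<p. e ^ (p - Suc i) * f ^ i) = ?p * e ^ (p - 1)] (mod ?p)"
      using c by (rule cong_dvd_modulus) simp
    thus "?p ^ 1 dvd (\<Sum>i<p. e ^ (p - Suc i) * f ^ i)" by (simp add: cong_dvd_iff)
    show "\<not> ?p ^ Suc 1 dvd (\<Sum>i<p. e ^ (p - Suc i) * f ^ i)"
    proof
      assume "?p ^ Suc 1 dvd (\<Sum>i<p. e ^ (p - Suc i) * f ^ i)"
      hence "?p ^ 2 dvd ?p * e ^ (p - 1)" using c by (simp add: cong_dvd_iff numeral_2_eq_2)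
      hence "?p dvd e ^ (p - 1)" using p2 by (simp add: power2_eq_square)
      thus False using assms by (auto dest: prime_int_dvd_power)
    qed
  qed
qed

text \<open>One factor \<open>p\<close> of \<open>n\<close> is stripped at a time, and each step
  contributes a geometric sum of valuation exactly 1; at 2 this is \<open>e ^ m + f ^ m\<close>,
  which the condition modulo 4 makes twice an odd number. Integers are used so that \<open>e\<close>
  may be replaced by \<open>- e\<close>.\<close>

lemma multiplicity_power_diff:
  fixes e f :: int
  assumes p: "prime p" and "int p dvd f - e" "\<not> int p dvd e"
    and "p = 2 \<Longrightarrow> even n \<Longrightarrow> 4 dvd f - e" "f ^ n \<noteq> e ^ n"
  shows "multiplicity (int p) (f ^ n - e ^ n) = multiplicity (int p) (f - e) + multiplicity p n"
  using assms(4,5)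
proof (induction n rule: less_induct)
  case (less n)
  have n0: "n > 0" using less.prems(2) by (cases n) auto
  have pe: "prime_elem (int p)" "prime_elem p" using p by auto
  have fe: "f \<noteq> e" using less.prems(2) by auto
  show ?case
  proof (cases "p dvd n")
    case False
    let ?S = "\<Sum>i<n. e ^ (n - Suc i) * f ^ i"
    have "f ^ n - e ^ n = (f - e) * ?S" by (rule power_diff_sumr2)
    moreover have "\<not> int p dvd ?S" using assms False by (intro not_dvd_geometric_sum) auto
    moreover have "?S \<noteq> 0" using calculation less.prems(2) by auto
    ultimately show ?thesis using fe False pe
      by (simp add: prime_elem_multiplicity_mult_distrib not_dvd_imp_multiplicity_0)
  next
    case True
    then obtain m where m: "n = p * m" by (auto simp: dvd_def)
    have m0: "m > 0" "m < n" using m n0 p prime_gt_1_nat[of p] by auto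
    have ne: "f ^ m \<noteq> e ^ m" using less.prems m by (metis power_mult mult.commute)
    have IH: "multiplicity (int p) (f ^ m - e ^ m) = multiplicity (int p) (f - e) + multiplicity p m"
      by (rule less.IH) (use m0 m ne less.prems(1) in auto)
    have d: "f - e dvd f ^ m - e ^ m" by (simp add: power_diff_sumr2)
    let ?S = "\<Sum>i<p. (e ^ m) ^ (p - Suc i) * (f ^ m) ^ i"
    have eq: "f ^ n - e ^ n = (f ^ m - e ^ m) * ?S"
      using power_diff_sumr2[of "f ^ m" p "e ^ m"] by (simp add: m power_mult[symmetric] mult.commute)
    have "multiplicity (int p) ?S = 1"
    proof (cases "p = 2")
      case False
      hence "odd p" using p primes_dvd_imp_eq two_is_prime_nat by blast
      thus ?thesis using assms d
        by (intro multiplicity_geometric_sum_prime) (auto dest: prime_int_dvd_power dvd_trans)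
    next
      case True
      have S: "?S = e ^ m + f ^ m" by (simp add: True numeral_2_eq_2)
      from d less.prems(1) True m have "4 dvd f ^ m - e ^ m" by (auto intro: dvd_trans)
      moreover have "odd (e ^ m)" using assms True by auto
      moreover have "2 ^ 1 dvd A + B" "\<not> 2 ^ Suc 1 dvd A + B" if "4 dvd B - A" "odd A" for A B :: int
        using that by auto presburger+
      ultimately have "2 ^ 1 dvd e ^ m + f ^ m" "\<not> 2 ^ Suc 1 dvd e ^ m + f ^ m" by blast+
      hence "multiplicity 2 (e ^ m + f ^ m) = 1" by (rule multiplicity_eqI)
      thus ?thesis unfolding S by (simp add: True)
    qed
    moreover have "?S \<noteq> 0" using eq less.prems(2) by auto
    ultimately show ?thesis unfolding eq using pe ne m0 IH
      by (simp add: prime_elem_multiplicity_mult_distrib m prime_gt_0_nat[OF p])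
  qed
qed

text \<open>By Bezout \<open>m * u = n * v + 1\<close>. Modulo \<open>p\<close> the powers with
  exponents \<open>m * u\<close> and \<open>n * v\<close> agree for \<open>e\<close> and
  \<open>f\<close>, and cancelling the latter, which are units, leaves \<open>f\<close> congruent to
  \<open>e\<close>.\<close>

lemma prime_dvd_diff_of_coprime_exponents:
  fixes e f :: int
  assumes p: "prime p" and "int p dvd f ^ m - e ^ m" "int p dvd f ^ n - e ^ n"
    and "\<not> int p dvd e" "coprime m n" "m > 0"
  shows "int p dvd f - e"
proof -
  obtain u v where uv: "m * u = n * v + 1" using bezout_nat[of m n] assms by auto
  have 1: "[f ^ m = e ^ m] (mod (int p))" "[f ^ n = e ^ n] (mod (int p))"
    using assms(2,3) by (simp_all add: cong_iff_dvd_diff)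
  have "[(f ^ m) ^ u = (e ^ m) ^ u] (mod (int p))" using 1(1) by (rule cong_pow)
  hence "[(f ^ n) ^ v * f = (e ^ n) ^ v * e] (mod (int p))"
    using uv by (simp add: power_mult[symmetric] power_add mult.commute)
  moreover have "[(f ^ n) ^ v * f = (e ^ n) ^ v * f] (mod (int p))"
    using cong_scalar_right[OF cong_pow[OF 1(2)]] .
  ultimately have "[(e ^ n) ^ v * f = (e ^ n) ^ v * e] (mod (int p))"
    by (metis cong_sym cong_trans)
  hence "int p dvd (e ^ n) ^ v * (f - e)" by (simp add: cong_iff_dvd_diff algebra_simps)
  hence "int p dvd (e ^ n) ^ v \<or> int p dvd f - e" using p by (simp add: prime_dvd_mult_iff)
  thus ?thesis using assms(4) p prime_int_dvd_power by blast
qed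

section \<open>Transfer from integers to natural numbers\<close>

lemma multiplicity_int: "prime p \<Longrightarrow> multiplicity (int p) (int n) = multiplicity p n"
proof (cases "n = 0")
  case False
  assume p: "prime p"
  show ?thesis
  proof (rule multiplicity_eqI)
    show "int p ^ multiplicity p n dvd int n"
      by (metis int_dvd_int_iff multiplicity_dvd of_nat_power)
    have "\<not> p ^ Suc (multiplicity p n) dvd n"
      using False p by (subst power_dvd_iff_le_multiplicity) auto
    thus "\<not> int p ^ Suc (multiplicity p n) dvd int n"
      by (metis int_dvd_int_iff of_nat_power)
  qed
qed simp

lemma multiplicity_power_diff_nat:
  fixes e f :: nat
  assumes p: "prime p" and "p dvd f - e" "\<not> p dvd e" "p = 2 \<Longrightarrow> even n \<Longrightarrow> 4 dvd f - e" "e < f" "n > 0"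
  shows "multiplicity p (f ^ n - e ^ n) = multiplicity p (f - e) + multiplicity p n"
proof -
  have lt: "e ^ n < f ^ n" using assms by (intro power_strict_mono) auto
  have i: "int f - int e = int (f - e)" "int f ^ n - int e ^ n = int (f ^ n - e ^ n)"
    using lt assms by (simp_all add: of_nat_diff)
  have "int f ^ n \<noteq> int e ^ n" using lt by (metis less_irrefl of_nat_eq_iff of_nat_power)
  moreover have "p = 2 \<Longrightarrow> even n \<Longrightarrow> 4 dvd int f - int e"
    using assms(4) by (metis i(1) int_dvd_int_iff of_nat_numeral)
  ultimately have "multiplicity (int p) (int f ^ n - int e ^ n) =
      multiplicity (int p) (int f - int e) + multiplicity p n"
    using assms by (intro multiplicity_power_diff) (simp_all only: i(1) int_dvd_int_iff simp_thms)
  thus ?thesis unfolding i using p by (simp only: multiplicity_int)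
qed

text \<open>This is the integer law at \<open>- int e\<close>: the odd exponent turns the difference
  into a sum and discharges the condition modulo 4.\<close>

lemma multiplicity_power_sum_nat:
  fixes e f :: nat
  assumes p: "prime p" and "p dvd f + e" "\<not> p dvd e" "odd n" "f > 0"
  shows "multiplicity p (f ^ n + e ^ n) = multiplicity p (f + e) + multiplicity p n"
proof -
  have i: "int f - (- int e) = int (f + e)" "int f ^ n - (- int e) ^ n = int (f ^ n + e ^ n)"
    using assms by simp_all
  have "int f ^ n + int e ^ n > 0" using assms by (intro add_pos_nonneg) auto
  hence "int f ^ n \<noteq> (- int e) ^ n" using assms by auto
  hence "multiplicity (int p) (int f ^ n - (- int e) ^ n) =
      multiplicity (int p) (int f - (- int e)) + multiplicity p n"
    using assms by (intro multiplicity_power_diff) (simp_all only: i(1) int_dvd_int_iff dvd_minus_iff simp_thms)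
  thus ?thesis unfolding i using p by (simp only: multiplicity_int)
qed

lemma of_nat_power_diff: "e \<le> f \<Longrightarrow> int (f ^ k - e ^ k) = int f ^ k - int e ^ k"
  by (simp add: of_nat_diff power_mono)

lemma prime_dvd_diff_of_coprime_exponents_nat:
  fixes e f :: nat
  assumes "prime p" "e \<le> f" "p dvd f ^ m - e ^ m" "p dvd f ^ n - e ^ n" "\<not> p dvd e" "coprime m n" "m > 0"
  shows "p dvd f - e"
proof -
  have "int p dvd int (f ^ m - e ^ m)" "int p dvd int (f ^ n - e ^ n)" "\<not> int p dvd int e"
    using assms by (simp_all only: int_dvd_int_iff simp_thms)
  hence "int p dvd int f - int e"
    unfolding of_nat_power_diff[OF assms(2)]
    using prime_dvd_diff_of_coprime_exponents[OF assms(1)] assms(6,7) by blast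
  thus ?thesis using assms(2) by (metis int_dvd_int_iff of_nat_diff)
qed

lemma diff_dvd_power_diff_nat:
  fixes e f :: nat
  assumes "e \<le> f"
  shows "f - e dvd f ^ m - e ^ m"
proof -
  have "int f - int e dvd int f ^ m - int e ^ m" by (simp add: power_diff_sumr2)
  thus ?thesis using assms by (metis int_dvd_int_iff of_nat_diff of_nat_power_diff)
qed

section \<open>Size comparisons for power differences and power sums\<close>

text \<open>Divide by \<open>C ^ (m * n)\<close>. With \<open>t = B / C\<close> strictly between 0
  and 1 the claim is \<open>(1 - t ^ m) ^ n < (1 - t ^ n) ^ m\<close>: on the right the base is
  larger, the exponent smaller, and both bases are below 1.\<close>

lemma power_diff_power_less:
  fixes B C :: nat
  assumes "0 < B" "B < C" "0 < m" "m < n"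
  shows "(C ^ m - B ^ m) ^ n < (C ^ n - B ^ n) ^ m"
proof -
  define t where "t = real B / real C"
  have t: "0 < t" "t < 1" using assms by (auto simp: t_def)
  have eq: "real (C ^ k - B ^ k) = real C ^ k * (1 - t ^ k)" for k
  proof -
    have "B ^ k \<le> C ^ k" using assms by (intro power_mono) auto
    thus ?thesis using assms by (simp add: of_nat_diff t_def algebra_simps power_divide)
  qed
  have lt: "t ^ n < t ^ m" using t assms by (intro power_strict_decreasing) auto
  have lt1: "0 < t ^ n" "t ^ m < 1" using t assms by (auto simp: power_less_one_iff)
  have "(1 - t ^ m) ^ n < (1 - t ^ n) ^ n" using lt lt1 assms by (intro power_strict_mono) auto
  also have "\<dots> \<le> (1 - t ^ n) ^ m" using lt lt1 assms by (intro power_decreasing) auto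
  finally have "(1 - t ^ m) ^ n < (1 - t ^ n) ^ m" .
  hence "(real C ^ m * (1 - t ^ m)) ^ n < (real C ^ n * (1 - t ^ n)) ^ m"
    using assms by (simp add: power_mult_distrib power_mult[symmetric] mult.commute)
  hence "real ((C ^ m - B ^ m) ^ n) < real ((C ^ n - B ^ n) ^ m)"
    by (simp only: of_nat_power eq)
  thus ?thesis by (simp only: of_nat_less_iff)
qed

text \<open>Strict decrease of the l^p norm in p. After scaling by the larger number, the side with
  exponent \<open>n\<close> outside has both the larger base, above 1, and the larger
  exponent.\<close>

lemma power_sum_power_less:
  fixes A B :: nat
  assumes "0 < A" "0 < B" "0 < m" "m < n"
  shows "(A ^ n + B ^ n) ^ m < (A ^ m + B ^ m) ^ n"
proof -
  have *: "(A ^ n + B ^ n) ^ m < (A ^ m + B ^ m) ^ n" if AB: "0 < A" "0 < B" "B \<le> A" for A B :: nat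
  proof -
    define t where "t = real B / real A"
    have t: "0 < t" "t \<le> 1" using AB by (auto simp: t_def)
    have eq: "real (A ^ k + B ^ k) = real A ^ k * (1 + t ^ k)" for k
      using AB by (simp add: t_def algebra_simps power_divide)
    have lt: "t ^ n \<le> t ^ m" using t assms by (intro power_decreasing) auto
    have pos: "0 < t ^ n" "0 < t ^ m" using t by auto
    have "(1 + t ^ n) ^ m \<le> (1 + t ^ m) ^ m" using lt pos by (intro power_mono) auto
    also have "\<dots> < (1 + t ^ m) ^ n" using pos assms by (intro power_strict_increasing) auto
    finally have "(1 + t ^ n) ^ m < (1 + t ^ m) ^ n" .
    hence "(real A ^ n * (1 + t ^ n)) ^ m < (real A ^ m * (1 + t ^ m)) ^ n"
      using AB by (simp add: power_mult_distrib power_mult[symmetric] mult.commute)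
    hence "real ((A ^ n + B ^ n) ^ m) < real ((A ^ m + B ^ m) ^ n)"
      by (simp only: of_nat_power eq)
    thus ?thesis by (simp only: of_nat_less_iff)
  qed
  show ?thesis
    using *[of A B] *[of B A] assms by (cases "B \<le> A") (auto simp: add.commute)
qed

lemma multiplicity_less_self: "prime p \<Longrightarrow> n > 0 \<Longrightarrow> multiplicity p n < (n::nat)"
proof -
  assume p: "prime p" "n > 0"
  have "multiplicity p n < p ^ multiplicity p n"
    using p by (intro power_gt_expt) (auto simp: prime_gt_Suc_0_nat)
  also have "\<dots> \<le> n" using p by (intro dvd_imp_le multiplicity_dvd)
  finally show ?thesis .
qed

lemma square_diff_nat: "(f::nat) ^ 2 - e ^ 2 = (f - e) * (f + e)"
proof (cases "e \<le> f")
  case True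
  then obtain d where "f = e + d" using le_Suc_ex by blast
  thus ?thesis by (simp add: power2_eq_square algebra_simps)
next
  case False
  thus ?thesis by (simp add: power_mono)
qed

text \<open>The counterpart of lifting the exponent: when lifting shows that
  \<open>f ^ m - e ^ m\<close> divides \<open>(f - e) * m\<close>, this strict bound leaves only
  \<open>m = 1\<close>.\<close>

lemma power_diff_gt:
  fixes e f :: nat
  assumes "e < f" "0 < e" "m \<ge> 2"
  shows "(f - e) * m < f ^ m - e ^ m"
  using assms(3)
proof (induction m rule: dec_induct)
  case base
  have "f ^ 2 - e ^ 2 = (f - e) * (f + e)" by (rule square_diff_nat)
  moreover have "f + e > 2" using assms by simp
  ultimately show ?case using assms by (simp only: mult_less_cancel1) simp
next
  case (step k)
  have le: "e ^ k \<le> f ^ k" using assms by (intro power_mono) simp_all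
  have "(f - e) * Suc k = (f - e) + (f - e) * k" by simp
  also have "\<dots> < f ^ k * (f - e) + e * (f ^ k - e ^ k)"
  proof (rule add_le_less_mono)
    show "f - e \<le> f ^ k * (f - e)" using assms by simp
    have "f ^ k - e ^ k \<le> e * (f ^ k - e ^ k)" using assms by simp
    with step.IH show "(f - e) * k < e * (f ^ k - e ^ k)" by linarith
  qed
  also have "\<dots> = f ^ Suc k - e ^ Suc k"
  proof -
    have "int (f ^ k * (f - e) + e * (f ^ k - e ^ k)) = int (f ^ Suc k - e ^ Suc k)"
      using assms le by (simp add: of_nat_diff mult_le_mono algebra_simps)
    thus ?thesis by (simp only: of_nat_eq_iff)
  qed
  finally show ?case .
qed

lemma coprime_decomposition:
  assumes "(B::nat) > 0"
  shows "\<exists>D e f. D > 0 \<and> B = D * e \<and> C = D * f \<and> coprime e f"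
proof -
  have "gcd B C \<noteq> 0" using assms by simp
  from gcd_coprime_exists[OF this] obtain e f
    where "B = e * gcd B C" "C = f * gcd B C" "coprime e f" by blast
  with \<open>gcd B C \<noteq> 0\<close> show ?thesis by (metis mult.commute neq0_conv)
qed

lemma multiplicity_prime_power_nat:
  fixes a :: nat
  shows "prime r \<Longrightarrow> a > 0 \<Longrightarrow> multiplicity r (a ^ x) = multiplicity r a * x"
  by (simp add: prime_elem_multiplicity_power_distrib mult.commute)

lemma multiplicity_power_mult:
  fixes D t :: nat
  assumes "prime r" "D > 0" "t > 0"
  shows "multiplicity r (D ^ m * t) = m * multiplicity r D + multiplicity r t"
  using assms by (subst prime_elem_multiplicity_mult_distrib)
    (simp_all add: prime_elem_multiplicity_power_distrib)

section \<open>Pairs of power differences and power sums\<close>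

text \<open>A prime factor of \<open>f ^ m - e ^ m\<close> divides \<open>a\<close>, so
  \<open>key\<close> applies to it; this forces it to divide \<open>f ^ n - e ^ n\<close>, hence
  \<open>f - e\<close>, and not to divide \<open>m\<close>. Lifting then makes
  \<open>f ^ m - e ^ m\<close> a divisor of \<open>f - e\<close>, so \<open>m = 1\<close> by size,
  and \<open>key\<close> becomes a strong condition on the primes of \<open>f - e\<close>.\<close>

lemma power_difference_pair:
  fixes a B C :: nat
  assumes a: "a > 1" and B: "B > 0" and n: "0 < m" "m < n" "coprime m n"
    and 1: "a ^ x + B ^ m = C ^ m" and 2: "a ^ x' + B ^ n = C ^ n"
  shows "m = 1 \<and> n * x < x' \<and> (\<exists>D e f. B = D * e \<and> C = D * f \<and> coprime e f \<and>
    (f = e + 1 \<or> f = e + 2 \<and> odd e \<and> even n))"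
proof -
  have BC: "B < C"
  proof (rule ccontr)
    assume "\<not> B < C"
    hence "C ^ m \<le> B ^ m" by (intro power_mono) auto
    moreover have "a ^ x > 0" using a by simp
    ultimately show False using 1 by linarith
  qed
  obtain D e f where D: "D > 0" and ef: "B = D * e" "C = D * f" "coprime e f"
    using coprime_decomposition[OF B] by blast
  have e: "e > 0" using ef(1) B by (cases e) auto
  have f: "e < f" using BC ef D by auto
  have lt: "e ^ k < f ^ k" if "k > 0" for k using f that by (intro power_strict_mono) auto
  have eq: "a ^ x = D ^ m * (f ^ m - e ^ m)" "a ^ x' = D ^ n * (f ^ n - e ^ n)"
    using 1 2 unfolding ef(1,2) by (simp_all add: power_mult_distrib diff_mult_distrib2)
  have val: "multiplicity r a * x = m * multiplicity r D + multiplicity r (f ^ m - e ^ m)"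
    "multiplicity r a * x' = n * multiplicity r D + multiplicity r (f ^ n - e ^ n)" if "prime r" for r
  proof -
    have p1: "f ^ m - e ^ m > 0" "f ^ n - e ^ n > 0" using lt[of m] lt[of n] n by linarith+
    have "a > 0" using a by simp
    note 3 = multiplicity_prime_power_nat[OF that this]
    show "multiplicity r a * x = m * multiplicity r D + multiplicity r (f ^ m - e ^ m)"
      using multiplicity_power_mult[OF that D p1(1), of m] 3[of x] eq(1) by metis
    show "multiplicity r a * x' = n * multiplicity r D + multiplicity r (f ^ n - e ^ n)"
      using multiplicity_power_mult[OF that D p1(2), of n] 3[of x'] eq(2) by metis
  qed
  have "(C ^ m - B ^ m) ^ n < (C ^ n - B ^ n) ^ m"
    using power_diff_power_less B BC n by auto
  moreover have "C ^ m - B ^ m = a ^ x" "C ^ n - B ^ n = a ^ x'" using 1 2 by linarith+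
  ultimately have "a ^ (x * n) < a ^ (x' * m)" by (simp only: power_mult)
  hence xx: "x * n < x' * m" by (rule power_less_imp_less_exp[OF a])
  \<comment> \<open>The size inequality \<open>x * n < x' * m\<close> eliminates the unknown contribution of \<open>D\<close>.\<close>
  have key: "n * multiplicity r (f ^ m - e ^ m) < m * multiplicity r (f ^ n - e ^ n)"
    if r: "prime r" "r dvd a" for r
  proof -
    have "multiplicity r a > 0" using r a by (auto simp: prime_multiplicity_gt_zero_iff)
    hence "multiplicity r a * (x * n) < multiplicity r a * (x' * m)" using xx by simp
    hence "(multiplicity r a * x) * n < (multiplicity r a * x') * m" by (simp only: mult.assoc)
    thus ?thesis unfolding val[OF r(1)] by (simp add: algebra_simps)
  qed
  have cop: "\<not> r dvd e" if "prime r" "r dvd f ^ k - e ^ k" "k > 0" for r k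
  proof
    assume "r dvd e"
    hence "r dvd e ^ k" using that by (simp add: dvd_power_le prime_dvd_power_iff)
    hence "r dvd f ^ k" using that lt[of k] by (metis dvd_diffD less_imp_le)
    hence "r dvd f" using that prime_dvd_power by blast
    thus False using \<open>r dvd e\<close> ef(3) that(1) by (meson coprime_common_divisor not_prime_unit)
  qed
  have dva: "r dvd a" if "prime r" "r dvd f ^ m - e ^ m" for r
    using that eq(1) by (metis dvd_mult prime_dvd_power)
  have 3: "r dvd f - e" "\<not> r dvd m" if r: "prime r" "r dvd f ^ m - e ^ m" for r
  proof -
    have k: "n * multiplicity r (f ^ m - e ^ m) < m * multiplicity r (f ^ n - e ^ n)"
      using key dva r by blast
    hence "multiplicity r (f ^ n - e ^ n) > 0" by (metis gr_zeroI mult_0_right not_less_zero)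
    hence rn: "r dvd f ^ n - e ^ n" using r
      by (metis not_dvd_imp_multiplicity_0 less_irrefl)
    show rfe: "r dvd f - e"
      by (rule prime_dvd_diff_of_coprime_exponents_nat[OF r(1) _ r(2) rn cop[OF r n(1)] n(3,1)])
        (use f in simp)
    show "\<not> r dvd m"
    proof
      assume rm: "r dvd m"
      hence rnn: "\<not> r dvd n" using n(3) r(1) by (meson coprime_common_divisor not_prime_unit)
      have "multiplicity r (f ^ n - e ^ n) = multiplicity r (f - e) + multiplicity r n"
        using r(1) rfe cop[OF r n(1)] n f rnn by (intro multiplicity_power_diff_nat) auto
      also have "\<dots> = multiplicity r (f - e)" using rnn by (simp add: not_dvd_imp_multiplicity_0)
      also have "multiplicity r (f - e) \<le> multiplicity r (f ^ m - e ^ m)"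
      proof (rule dvd_imp_multiplicity_le)
        show "f - e dvd f ^ m - e ^ m" by (rule diff_dvd_power_diff_nat) (use f in simp)
      qed (use lt[of m] n in linarith)
      finally have "m * multiplicity r (f ^ n - e ^ n) \<le> n * multiplicity r (f ^ m - e ^ m)"
        using n by (intro mult_le_mono) simp_all
      thus False using k by simp
    qed
  qed
  have "f ^ m - e ^ m dvd f - e"
  proof (rule multiplicity_le_imp_dvd)
    fix r :: nat assume r: "prime r"
    show "multiplicity r (f ^ m - e ^ m) \<le> multiplicity r (f - e)"
    proof (cases "r dvd f ^ m - e ^ m")
      case True
      have "r = 2 \<Longrightarrow> even m \<Longrightarrow> 4 dvd f - e" using 3(2)[OF r True] by blast
      hence "multiplicity r (f ^ m - e ^ m) = multiplicity r (f - e) + multiplicity r m"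
        using r 3(1)[OF r True] cop[OF r True n(1)] f n(1) by (intro multiplicity_power_diff_nat)
      thus ?thesis using not_dvd_imp_multiplicity_0[OF 3(2)[OF r True]] by linarith
    qed (simp add: not_dvd_imp_multiplicity_0)
  qed (use lt[of m] n in linarith)
  hence "f ^ m - e ^ m \<le> f - e" using f by (intro dvd_imp_le) simp_all
  moreover have "(f - e) * 2 \<le> (f - e) * m" if "m \<ge> 2" using that by simp
  moreover have "m \<ge> 2 \<Longrightarrow> (f - e) * m < f ^ m - e ^ m" using power_diff_gt[OF f e] .
  ultimately have m: "m = 1" using f n(1) by linarith
  \<comment> \<open>If lifting applied, then with v = v(f - e) at least 1 one would have n*v < v +
    v(n), although v(n) is at most n - 1 and so at most (n - 1)*v. Hence \<open>r\<close> is the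
    prime at which lifting fails.\<close>
  have 4: "r = 2 \<and> even n \<and> \<not> 4 dvd f - e" if r: "prime r" "r dvd f - e" for r
  proof (rule ccontr)
    assume neg: "\<not> (r = 2 \<and> even n \<and> \<not> 4 dvd f - e)"
    have "\<not> r dvd e" using cop[of r 1] r by simp
    moreover have "r = 2 \<Longrightarrow> even n \<Longrightarrow> 4 dvd f - e" using neg by blast
    ultimately have "multiplicity r (f ^ n - e ^ n) = multiplicity r (f - e) + multiplicity r n"
      using r f n by (intro multiplicity_power_diff_nat) linarith+
    moreover have "n * multiplicity r (f - e) < multiplicity r (f ^ n - e ^ n)"
      using key[of r] dva[of r] r unfolding m by simp
    moreover have "multiplicity r n < n" using n r by (intro multiplicity_less_self) linarith+
    moreover have "multiplicity r (f - e) > 0"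
      using r f by (simp add: prime_multiplicity_gt_zero_iff)
    moreover obtain k where k: "n = Suc k" using n(2) by (cases n) simp_all
    moreover have "n * multiplicity r (f - e) = multiplicity r (f - e) + k * multiplicity r (f - e)"
      by (simp add: k)
    moreover have "k * 1 \<le> k * multiplicity r (f - e)"
      using \<open>multiplicity r (f - e) > 0\<close> by (intro mult_le_mono2) simp
    ultimately show False by linarith
  qed
  have "f - e = 1 \<or> f - e = 2 \<and> even n"
  proof (cases "f - e = 1")
    case False
    then obtain r where "prime r" "r dvd f - e" using prime_factor_nat[of "f - e"] by blast
    with 4[of r] have 5: "even n" "\<not> 4 dvd f - e" "2 dvd f - e" by blast+
    then obtain k where k: "f - e = 2 * k" unfolding dvd_def by blast
    have "k = 1"
    proof (rule ccontr)
      assume "k \<noteq> 1"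
      then obtain r where r: "prime r" "r dvd k" using prime_factor_nat[of k] by blast
      have "r dvd f - e" using r k by simp
      with 4[of r] r have "2 dvd k" by blast
      then obtain j where "k = 2 * j" unfolding dvd_def by blast
      hence "f - e = 4 * j" using k by simp
      with 5 show False by simp
    qed
    thus ?thesis using k 5 by simp
  qed simp
  moreover have "odd e" if "f - e = 2" using cop[of 2 1] that by simp
  ultimately have "f = e + 1 \<or> f = e + 2 \<and> odd e \<and> even n" using f by linarith
  moreover have "n * x < x'" using xx unfolding m by (simp add: mult.commute)
  ultimately show ?thesis using m ef by blast
qed

section \<open>Power sums\<close>

lemma power_of_prime_if_unique_prime_factor:
  fixes n q :: nat
  assumes "n > 0" "prime q" "\<And>r. prime r \<Longrightarrow> r dvd n \<Longrightarrow> r = q"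
  shows "\<exists>k. n = q ^ k"
proof -
  have "n \<noteq> 0" "\<not> is_unit q" using assms(1,2) by auto
  then obtain x where x: "n = q ^ multiplicity q n * x" "\<not> q dvd x"
    using multiplicity_decompose' by blast
  have "x = 1"
  proof (rule ccontr)
    assume "x \<noteq> 1"
    then obtain r where r: "prime r" "r dvd x" using prime_factor_nat by blast
    hence "r dvd n" using x(1) by (metis dvd_mult)
    with assms(3)[of r] r x(2) show False by blast
  qed
  thus ?thesis using x(1) by (metis mult_1_right)
qed

lemma odd_power_even_mod_4:
  assumes "odd (f::nat)" "even n"
  shows "f ^ n mod 4 = 1"
proof -
  obtain j where j: "n = 2 * j" using assms by (auto elim!: evenE)
  obtain i where "f = 2 * i + 1" using assms by (auto elim!: oddE)
  hence "f ^ 2 = 1 + 4 * (i * i + i)" by (simp add: power2_eq_square algebra_simps)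
  hence "f ^ 2 mod 4 = 1" by simp
  hence "(f ^ 2) ^ j mod 4 = 1" by (metis power_mod power_one mod_mod_trivial)
  thus ?thesis by (simp add: j power_mult)
qed

text \<open>With \<open>n = k + 1\<close>, the bounds \<open>f ^ k \<ge> 2 ^ k\<close> and
  \<open>e < f\<close> reduce the inequality to \<open>2 ^ k < 2 * k + 1\<close>, so
  \<open>k = 2\<close>. The cofactor f^2 - f*e + e^2 of the sum of cubes is then at most 3.\<close>

lemma cube_sum_if_power_sum_le:
  fixes e f n :: nat
  assumes "0 < e" "e < f" "odd n" "n > 1" and le: "f ^ n + e ^ n \<le> (f + e) * n"
  shows "n = 3 \<and> f = 2 \<and> e = 1"
proof -
  obtain k where k: "n = Suc k" "k \<ge> 2" using assms(3,4) by (cases n) (auto elim!: oddE)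
  have "2 ^ k * f \<le> f ^ k * f" using assms by (intro mult_right_mono power_mono) auto
  also have "\<dots> = f ^ n" by (simp add: k)
  also have "\<dots> + e \<le> (f + e) * n" using le self_le_power[of e n] assms by simp
  finally have "2 ^ k * f + e \<le> f * n + e * n" by (simp add: algebra_simps)
  moreover have "e * k < f * k" using assms k by simp
  moreover have "e * n = e * k + e" by (simp add: k)
  ultimately have "2 ^ k * f < f * n + f * k" by linarith
  hence "f * 2 ^ k < f * (n + k)" by (simp add: algebra_simps)
  hence "2 ^ k < n + k" by simp
  hence k2: "2 ^ k < 2 * k + 1" by (simp add: k)
  have "k < 3"
  proof (rule ccontr)
    assume "\<not> k < 3"
    hence "k \<ge> 3" by simp
    hence "2 * k + 1 \<le> 2 ^ k" by (induction k rule: dec_induct) auto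
    with k2 show False by simp
  qed
  hence n3: "n = 3" using k by simp
  have "f = 2 \<and> e = 1"
  proof -
    define d where "d = f - e"
    have f: "f = e + d" "d > 0" using assms by (auto simp: d_def)
    have "f ^ 3 + e ^ 3 = (f + e) * (e * e + e * d + d * d)"
      by (simp add: f power3_eq_cube algebra_simps)
    hence "(f + e) * (e * e + e * d + d * d) \<le> (f + e) * 3" using le by (simp add: n3)
    hence le3: "e * e + e * d + d * d \<le> 3" using assms(1) by (simp only: mult_le_cancel1)
    have "e * e \<ge> e" "d * d \<ge> d" "e * d \<ge> 1" using f assms by auto
    hence "e + d \<le> 2" using le3 by linarith
    thus ?thesis using f assms by auto
  qed
  thus ?thesis using n3 by simp
qed

text \<open>Here \<open>key\<close> bounds the valuation of \<open>f ^ n + e ^ n\<close> from above,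
  so each prime of \<open>c\<close> divides \<open>f ^ m + e ^ m\<close>; since primes of
  \<open>f ^ n + e ^ n\<close> divide \<open>c\<close>, they divide both sums. This puts them into
  \<open>f + e\<close>, and lifting makes \<open>f ^ n + e ^ n\<close> a divisor of
  \<open>(f + e) * n\<close>, small enough to leave only 2^3 + 1^3.\<close>

lemma power_sum_pair_coprime:
  fixes c D e f :: nat
  assumes c: "c > 1" and D: "D > 0" and ef: "0 < e" "e < f" "coprime e f"
    and n: "0 < m" "m < n" "coprime m n"
    and 1: "(D * f) ^ m + (D * e) ^ m = c ^ z" and 2: "(D * f) ^ n + (D * e) ^ n = c ^ z'"
  shows "m = 1 \<and> n = 3 \<and> f = 2 \<and> e = 1 \<and> (\<forall>r. prime r \<longrightarrow> r dvd c \<longrightarrow> r = 3)"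
proof -
  have pos: "f ^ k + e ^ k > 0" for k using ef by simp
  have eq: "c ^ z = D ^ m * (f ^ m + e ^ m)" "c ^ z' = D ^ n * (f ^ n + e ^ n)"
    using 1 2 by (simp_all add: power_mult_distrib algebra_simps)
  have c0: "c > 0" using c by simp
  have val: "multiplicity r c * z = m * multiplicity r D + multiplicity r (f ^ m + e ^ m)"
    "multiplicity r c * z' = n * multiplicity r D + multiplicity r (f ^ n + e ^ n)" if "prime r" for r
    using multiplicity_power_mult[OF that D pos] multiplicity_prime_power_nat[OF that c0] eq by metis+
  have "((D * f) ^ n + (D * e) ^ n) ^ m < ((D * f) ^ m + (D * e) ^ m) ^ n"
    using power_sum_power_less[of "D * f" "D * e" m n] D ef n by simp
  hence "c ^ (z' * m) < c ^ (z * n)" unfolding 1 2 by (simp only: power_mult)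
  hence zz: "z' * m < z * n" by (rule power_less_imp_less_exp[OF c])
  have key: "m * multiplicity r (f ^ n + e ^ n) < n * multiplicity r (f ^ m + e ^ m)"
    if r: "prime r" "r dvd c" for r
  proof -
    have "multiplicity r c > 0" using r c by (simp add: prime_multiplicity_gt_zero_iff)
    hence "multiplicity r c * (z' * m) < multiplicity r c * (z * n)" using zz by simp
    hence "(multiplicity r c * z') * m < (multiplicity r c * z) * n" by (simp only: mult.assoc)
    thus ?thesis unfolding val[OF r(1)] by (simp add: algebra_simps)
  qed
  have rm: "r dvd f ^ m + e ^ m" if r: "prime r" "r dvd c" for r
    using key[OF r] not_dvd_imp_multiplicity_0[of r "f ^ m + e ^ m"] by fastforce
  have rc: "r dvd c" if r: "prime r" "r dvd f ^ n + e ^ n" for r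
    using r eq(2) by (metis dvd_mult prime_dvd_power)
  have cop: "\<not> r dvd e" if r: "prime r" "r dvd f ^ k + e ^ k" "k > 0" for r k
  proof
    assume re: "r dvd e"
    hence "r dvd e ^ k" using r by (simp add: prime_dvd_power_iff)
    hence "r dvd f ^ k" using r(2) by (metis dvd_add_left_iff)
    hence "r dvd f" using r prime_dvd_power by blast
    thus False using re ef(3) r(1) by (meson coprime_common_divisor not_prime_unit)
  qed
  have fm: "int f ^ k - (- int e) ^ k = int (f ^ k + e ^ k)" if "odd k" for k using that by simp
  have odd_case: "r dvd f + e" if r: "prime r" "r dvd f ^ n + e ^ n" and "odd m" "odd n" for r
  proof -
    have "int r dvd int f ^ m - (- int e) ^ m"
      unfolding fm[OF \<open>odd m\<close>] int_dvd_int_iff by (rule rm[OF r(1) rc[OF r]])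
    moreover have "int r dvd int f ^ n - (- int e) ^ n"
      unfolding fm[OF \<open>odd n\<close>] int_dvd_int_iff by (rule r(2))
    moreover have "\<not> int r dvd - int e" using cop[OF r] n by simp
    ultimately have "int r dvd int f - (- int e)"
      using prime_dvd_diff_of_coprime_exponents[OF r(1)] n(1,3) by blast
    hence "int r dvd int (f + e)" by simp
    thus ?thesis by (simp only: int_dvd_int_iff)
  qed
  \<comment> \<open>Coprime exponents applied to the squares give \<open>r dvd f^2 - e^2\<close>.
    For an even exponent \<open>k\<close> this makes f^k congruent to e^k as well as to -e^k, so
    \<open>r\<close> divides 2*e^k.\<close>
  have even_case: "r = 2" if r: "prime r" "r dvd f ^ n + e ^ n" and ev: "even m \<or> even n" for r
  proof -
    have rm': "r dvd f ^ m + e ^ m" by (rule rm[OF r(1) rc[OF r]])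
    have re: "\<not> r dvd e" using cop[OF r] n by simp
    have sq: "int r dvd (int f ^ 2) ^ k - (int e ^ 2) ^ k" if "r dvd f ^ k + e ^ k" for k
    proof -
      have "(int f ^ 2) ^ k - (int e ^ 2) ^ k = (int f ^ k + int e ^ k) * (int f ^ k - int e ^ k)"
        unfolding power_commutes power2_eq_square power_mult_distrib by (simp add: algebra_simps)
      also have "int f ^ k + int e ^ k = int (f ^ k + e ^ k)" by simp
      finally show ?thesis using that by (metis dvd_mult2 int_dvd_int_iff)
    qed
    have "\<not> int r dvd int e ^ 2" using re r(1) by (metis int_dvd_int_iff prime_int_dvd_power)
    hence d2: "int r dvd int f ^ 2 - int e ^ 2"
      using prime_dvd_diff_of_coprime_exponents[OF r(1) sq[OF rm'] sq[OF r(2)]] n(1,3) by blast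
    obtain k where k: "even k" "r dvd f ^ k + e ^ k" using ev rm' r(2) by blast
    then obtain j where j: "k = 2 * j" by (auto elim!: evenE)
    have "int f ^ 2 - int e ^ 2 dvd (int f ^ 2) ^ j - (int e ^ 2) ^ j"
      by (subst power_diff_sumr2[of "int f ^ 2" j]) simp
    hence "int r dvd int f ^ k - int e ^ k" using d2 by (simp add: j power_mult dvd_trans)
    moreover have "int r dvd int f ^ k + int e ^ k"
      using k(2) by (metis int_dvd_int_iff of_nat_add of_nat_power)
    ultimately have "int r dvd (int f ^ k + int e ^ k) - (int f ^ k - int e ^ k)" by (rule dvd_diff[rotated])
    hence "int r dvd int 2 * int e ^ k" by simp
    hence "int r dvd int 2 \<or> int r dvd int e ^ k" using r(1) by (simp add: prime_dvd_mult_iff)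
    moreover have "\<not> int r dvd int e ^ k" using re r(1) by (metis int_dvd_int_iff prime_int_dvd_power)
    ultimately have "r dvd 2" by (simp only: int_dvd_int_iff simp_thms)
    thus ?thesis using r(1) by (simp add: primes_dvd_imp_eq)
  qed
  have n2: "n \<ge> 2" using n by simp
  have f2: "f \<ge> 2" using ef by simp
  have "f < f ^ n" using power_strict_increasing[of 1 n f] n2 f2 by simp
  hence gt2: "f ^ n + e ^ n > 2" using f2 by simp
  \<comment> \<open>For even \<open>n\<close> the sum would be a power of 2 above 2, hence divisible
    by 4; but two even powers of odd numbers add up to 2 modulo 4.\<close>
  have oddn: "odd n"
  proof
    assume ev: "even n"
    have only2: "r = 2" if "prime r" "r dvd f ^ n + e ^ n" for r using even_case that ev by blast
    obtain k where k: "f ^ n + e ^ n = 2 ^ k"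
      using power_of_prime_if_unique_prime_factor[OF pos two_is_prime_nat only2] by blast
    have "k \<ge> 2"
    proof (rule ccontr)
      assume "\<not> k \<ge> 2"
      hence "k = 0 \<or> k = 1" by auto
      thus False using k gt2 by auto
    qed
    hence "(2::nat) ^ 2 dvd 2 ^ k" by (rule le_imp_power_dvd)
    hence d4: "4 dvd f ^ n + e ^ n" by (simp add: k)
    hence "even (f ^ n + e ^ n)" using dvd_trans[of 2 4 "f ^ n + e ^ n"] by simp
    hence "odd e" using cop[of 2 n] n by simp
    moreover have "odd f" using \<open>even (f ^ n + e ^ n)\<close> \<open>odd e\<close> n by auto
    ultimately have "f ^ n mod 4 = 1" "e ^ n mod 4 = 1" using ev
      by (simp_all add: odd_power_even_mod_4)
    hence "(f ^ n + e ^ n) mod 4 = 2" by (simp add: mod_add_eq[symmetric])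
    thus False using d4 by (simp add: dvd_eq_mod_eq_0)
  qed
  have "f ^ n + e ^ n dvd (f + e) * n"
  proof (rule multiplicity_le_imp_dvd)
    fix r :: nat assume r: "prime r"
    show "multiplicity r (f ^ n + e ^ n) \<le> multiplicity r ((f + e) * n)"
    proof (cases "r dvd f ^ n + e ^ n")
      case True
      have re: "\<not> r dvd e" using cop[OF r True] n by simp
      have "r dvd f + e"
      proof (cases "odd m")
        case False
        hence [simp]: "r = 2" using even_case[OF r True] by simp
        have "odd e" using re by simp
        moreover have "odd f" using True \<open>odd e\<close> n by auto
        ultimately show ?thesis by simp
      qed (use odd_case r True oddn in blast)
      hence "multiplicity r (f ^ n + e ^ n) = multiplicity r (f + e) + multiplicity r n"
        using r re oddn ef by (intro multiplicity_power_sum_nat) simp_all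
      also have "\<dots> = multiplicity r ((f + e) * n)"
        using r ef n by (subst prime_elem_multiplicity_mult_distrib) simp_all
      finally show ?thesis by simp
    qed (simp add: not_dvd_imp_multiplicity_0)
  qed (use pos[of n] in simp)
  hence "f ^ n + e ^ n \<le> (f + e) * n" using ef n by (intro dvd_imp_le) simp_all
  with ef oddn n2 have *: "n = 3 \<and> f = 2 \<and> e = 1" by (intro cube_sum_if_power_sum_le) simp_all
  hence "(3::nat) dvd f ^ n + e ^ n" by simp
  hence "m \<noteq> 2" using even_case[of 3] by auto
  hence "m = 1" using n * by auto
  moreover have "r = 3" if "prime r" "r dvd c" for r
    using rm[OF that] * \<open>m = 1\<close> that(1) by (simp add: primes_dvd_imp_eq)
  ultimately show ?thesis using * by blast
qed

section \<open>Equations involving powers of two\<close>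

text \<open>A gap of 2 is too small for lifting at 2, so the law is applied to the squares, whose
  difference \<open>4 * (d + 1)\<close> qualifies. The formula is the arithmetic content of the last
  condition of family (iv).\<close>

lemma multiplicity_even_power_gap_two:
  fixes d k :: nat
  assumes "odd d" "even k" "k > 0"
  shows "multiplicity 2 ((d + 2) ^ k - d ^ k) = multiplicity 2 (2 * d + 2) + multiplicity 2 k"
proof -
  obtain j where j: "k = 2 * j" using assms(2) by (auto elim!: evenE)
  have j0: "j > 0" using assms j by simp
  have d: "(d + 2)\<^sup>2 - d\<^sup>2 = 2 * (2 * d + 2)" by (simp add: square_diff_nat)
  have "multiplicity 2 (((d + 2)\<^sup>2) ^ j - (d\<^sup>2) ^ j) =
      multiplicity 2 ((d + 2)\<^sup>2 - d\<^sup>2) + multiplicity 2 j"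
  proof (rule multiplicity_power_diff_nat)
    have "(d + 2)\<^sup>2 - d\<^sup>2 = 4 * (d + 1)" by (simp add: square_diff_nat)
    thus "4 dvd (d + 2)\<^sup>2 - d\<^sup>2" by (metis dvd_triv_left)
    show "(2::nat) dvd (d + 2)\<^sup>2 - d\<^sup>2" unfolding d by (rule dvd_triv_left)
    show "d\<^sup>2 < (d + 2)\<^sup>2" by (intro power_strict_mono) simp_all
  qed (use assms j0 in simp_all)
  moreover have "multiplicity 2 (2 * (2 * d + 2)) = Suc (multiplicity 2 (2 * d + 2))"
    by (rule multiplicity_times_same) simp_all
  moreover have "multiplicity 2 (2 * j) = Suc (multiplicity 2 j)"
    using j0 by (intro multiplicity_times_same) simp_all
  ultimately show ?thesis by (simp only: d j power_mult)
qed

lemma base_power_of_prime: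
  fixes a q :: nat
  assumes "prime q" "a ^ h = q ^ j" "h > 0"
  shows "\<exists>i. a = q ^ i"
proof (rule power_of_prime_if_unique_prime_factor)
  have "a ^ h > 0" using assms by (simp add: prime_gt_0_nat)
  thus "a > 0" using assms(3) by (cases a) simp_all
  fix r :: nat assume r: "prime r" "r dvd a"
  hence "r dvd q ^ j" using assms by (metis dvd_power dvd_trans)
  thus "r = q" using r assms by (meson prime_dvd_power primes_dvd_imp_eq)
qed (use assms in simp)

text \<open>Modulo 4 the exponent \<open>y\<close> must be odd. Lifting at 2 then puts the whole of
  \<open>2 ^ H\<close> into \<open>b + 1\<close>, so \<open>b ^ y \<le> b\<close>.\<close>

lemma pow2_minus_one_not_perfect_power:
  fixes b :: nat
  assumes "b ^ y + 1 = 2 ^ H" "H \<ge> 2"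
  shows "y = 1"
proof -
  have d4: "(4::nat) dvd 2 ^ H" using le_imp_power_dvd[OF assms(2), of 2] by simp
  have "even ((2::nat) ^ H)" using assms(2) by simp
  hence ob: "odd (b ^ y)" using assms(1) by presburger
  have y0: "y > 0"
  proof (rule ccontr)
    assume "\<not> y > 0"
    hence "(2::nat) ^ H = 2" using assms(1) by simp
    thus False using d4 by simp
  qed
  have b: "odd b" using ob y0 by simp
  have oy: "odd y"
  proof
    assume "even y"
    hence "b ^ y mod 4 = 1" using b by (rule odd_power_even_mod_4[rotated])
    hence "(b ^ y + 1) mod 4 = 2" by presburger
    thus False using d4 assms(1) by (simp add: dvd_eq_mod_eq_0)
  qed
  have "multiplicity 2 (b ^ y + 1 ^ y) = multiplicity 2 (b + 1) + multiplicity 2 y"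
    using b oy by (intro multiplicity_power_sum_nat) (auto intro: Nat.gr0I elim!: oddE)
  hence "multiplicity 2 (b + 1) = H" using oy assms(1) by (simp add: not_dvd_imp_multiplicity_0)
  hence "2 ^ H dvd b + 1" by (metis multiplicity_dvd)
  hence "b ^ y \<le> b" using assms(1) by (metis add_le_cancel_right add_gr_0 dvd_imp_le zero_less_one)
  moreover have "b > 1"
  proof (rule ccontr)
    assume "\<not> b > 1"
    hence "b = 1" using b by (cases b) auto
    hence "(2::nat) ^ H = 2" using assms(1) by simp
    thus False using d4 by simp
  qed
  ultimately have "y \<le> 1" using power_strict_increasing[of 1 y b] by (cases "y \<le> 1") auto
  thus ?thesis using y0 by simp
qed

text \<open>For odd \<open>z\<close> lifting puts all of \<open>2 ^ H\<close> into
  \<open>c - 1\<close>. For even \<open>z\<close> the factors of \<open>c ^ z - 1\<close> are powers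
  of 2 that differ by 2, hence 2 and 4, which gives 9 = 2^3 + 1.\<close>

lemma pow2_plus_one_perfect_power:
  fixes c :: nat
  assumes "c ^ z = 2 ^ H + 1" "H \<ge> 1" "z > 0"
  shows "z = 1 \<or> c = 3 \<and> z = 2 \<and> H = 3"
proof (cases "odd z")
  case True
  have "odd (c ^ z)" unfolding assms(1) using assms(2) by simp
  hence c: "odd c" using assms(3) by simp
  have c1: "c > 1"
  proof (rule ccontr)
    assume "\<not> c > 1"
    hence "c = 1" using c by (cases c) auto
    thus False using assms by simp
  qed
  have "multiplicity 2 (c ^ z - 1 ^ z) = multiplicity 2 (c - 1) + multiplicity 2 z"
    using c c1 True assms(3) by (intro multiplicity_power_diff_nat) simp_all
  hence "multiplicity 2 (c - 1) = H" using True assms(1) by (simp add: not_dvd_imp_multiplicity_0)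
  hence "2 ^ H dvd c - 1" by (metis multiplicity_dvd)
  hence "2 ^ H \<le> c - 1" using c1 by (intro dvd_imp_le) simp_all
  hence "c ^ z \<le> c" using assms(1) c1 by linarith
  hence "z \<le> 1" using power_strict_increasing[of 1 z c] c1 by (cases "z \<le> 1") auto
  thus ?thesis using assms(3) by simp
next
  case False
  then obtain k where k: "z = 2 * k" by (auto elim!: evenE)
  have "(c ^ k)\<^sup>2 - 1\<^sup>2 = 2 ^ H" using assms(1) by (simp add: k power_mult[symmetric] mult.commute)
  hence eq: "(c ^ k - 1) * (c ^ k + 1) = 2 ^ H" by (simp only: square_diff_nat)
  obtain i where i: "c ^ k - 1 = 2 ^ i"
    using divides_primepow_nat[of 2 "c ^ k - 1" H] eq by (metis dvd_triv_left two_is_prime_nat)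
  obtain j where j: "c ^ k + 1 = 2 ^ j"
    using divides_primepow_nat[of 2 "c ^ k + 1" H] eq by (metis dvd_triv_right two_is_prime_nat)
  have ck: "c ^ k = 2 ^ i + 1" using i by (metis add.commute diff_is_0_eq le_add_diff_inverse
        nat_le_linear power_not_zero zero_neq_numeral)
  have ij: "2 ^ j = 2 ^ i + (2::nat)" using ck j by simp
  have "i = 1"
  proof (rule ccontr)
    assume "i \<noteq> 1"
    have "j \<ge> 2"
    proof (rule ccontr)
      assume "\<not> j \<ge> 2"
      hence "j = 0 \<or> j = 1" by auto
      thus False using ij by auto
    qed
    hence "(4::nat) dvd 2 ^ j" using le_imp_power_dvd[of 2 j 2] by simp
    moreover have "i = 0 \<or> i \<ge> 2" using \<open>i \<noteq> 1\<close> by auto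
    moreover have "(4::nat) dvd 2 ^ i" if "i \<ge> 2" using le_imp_power_dvd[OF that, of 2] by simp
    ultimately show False using ij dvd_add_right_iff[of 4 "2 ^ i" "2 :: nat"] by (auto dest: dvd_imp_le)
  qed
  hence c3: "c ^ k = 3" using ck by simp
  have k0: "k > 0" using assms(3) k by simp
  have "k = 1"
    using c3 pow2_minus_one_not_perfect_power[of c k 2] by simp
  thus ?thesis using c3 eq k power_inject_exp[of 2 3 H] by auto
qed

text \<open>With \<open>n = 2 * j\<close>, lifting for the squares shows that \<open>2 ^ s\<close>
  divides \<open>4 * (e + 1) * j\<close>, which is smaller than \<open>2 ^ s\<close> unless
  \<open>j = 1\<close>. Then \<open>2 ^ s = 4 * (e + 1)\<close>.\<close>

lemma even_power_gap_two_pow2: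
  fixes e n :: nat
  assumes "odd e" "even n" "n > 0" "2 ^ s + e ^ n = (e + 2) ^ n"
  shows "n = 2 \<and> (\<exists>H\<ge>1. e + 1 = 2 ^ H)"
proof -
  obtain j where j: "n = 2 * j" using assms(2) by (auto elim!: evenE)
  have j0: "j > 0" using assms j by simp
  have e: "e > 0" using assms(1) by (auto elim!: oddE)
  have d: "(e + 2)\<^sup>2 - e\<^sup>2 = 4 * (e + 1)" by (simp add: square_diff_nat)
  have s: "((e + 2)\<^sup>2) ^ j - (e\<^sup>2) ^ j = 2 ^ s"
    using assms(4) by (simp add: j power_mult[symmetric])
  have "multiplicity 2 (((e + 2)\<^sup>2) ^ j - (e\<^sup>2) ^ j) =
      multiplicity 2 ((e + 2)\<^sup>2 - e\<^sup>2) + multiplicity 2 j"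
  proof (rule multiplicity_power_diff_nat)
    show "4 dvd (e + 2)\<^sup>2 - e\<^sup>2" unfolding d by (rule dvd_triv_left)
    show "(2::nat) dvd (e + 2)\<^sup>2 - e\<^sup>2" unfolding d by simp
    show "e\<^sup>2 < (e + 2)\<^sup>2" by (intro power_strict_mono) simp_all
  qed (use assms j0 in simp_all)
  also have "\<dots> = multiplicity 2 (((e + 2)\<^sup>2 - e\<^sup>2) * j)"
    using j0 unfolding d by (subst prime_elem_multiplicity_mult_distrib) simp_all
  finally have "multiplicity 2 (((e + 2)\<^sup>2 - e\<^sup>2) * j) = s" unfolding s by simp
  hence "2 ^ s dvd ((e + 2)\<^sup>2 - e\<^sup>2) * j" by (metis multiplicity_dvd)
  hence "2 ^ s \<le> ((e + 2)\<^sup>2 - e\<^sup>2) * j" using j0 unfolding d by (intro dvd_imp_le) simp_all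
  moreover have "((e + 2)\<^sup>2 - e\<^sup>2) * j < 2 ^ s" if "j \<ge> 2"
    unfolding s[symmetric] using e that by (intro power_diff_gt power_strict_mono) simp_all
  ultimately have j1: "j = 1" using j0 by linarith
  hence n2: "n = 2" using j by simp
  have "2 ^ s = 4 * (e + 1)" using s unfolding j1 power_one_right d by simp
  hence "e + 1 dvd 2 ^ s" by (metis dvd_triv_right)
  then obtain H where H: "e + 1 = 2 ^ H" using divides_primepow_nat[of 2 "e + 1" s] by auto
  have "H \<noteq> 0" using H e by (cases H) auto
  thus ?thesis using n2 H by (intro conjI exI[of _ H]) simp_all
qed

text \<open>Both numbers are 3 modulo 4, so \<open>x\<close> and \<open>y\<close> have equal parity
  and are halved together while even. Once they are odd, the 2-adic valuation of
  \<open>a ^ x + 1 = b ^ y + 1\<close> recovers both \<open>m\<close> and \<open>n\<close>.\<close>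

lemma mersenne_powers_eq:
  fixes a b :: nat
  assumes "a + 1 = 2 ^ m" "b + 1 = 2 ^ n" "m \<ge> 2" "n \<ge> 2" "a ^ x = b ^ y" "x > 0"
  shows "a = b"
  using assms(5,6)
proof (induction x arbitrary: y rule: less_induct)
  case (less x)
  have mod4: "k mod 4 = 3" if "k + 1 = 2 ^ h" "h \<ge> 2" for k h :: nat
  proof -
    have "(4::nat) dvd 2 ^ h" using le_imp_power_dvd[OF that(2), of 2] by simp
    hence "4 dvd k + 1" by (simp only: that(1))
    thus ?thesis by presburger
  qed
  have o: "odd a" "odd b" using mod4[OF assms(1,3)] mod4[OF assms(2,4)] by presburger+
  have odd3: "k ^ h mod 4 = 3" if k3: "k mod 4 = 3" and oh: "odd h" for k h :: nat
  proof -
    obtain j where j: "h = Suc (2 * j)" using oh by (auto elim!: oddE)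
    have "odd k" using k3 by presburger
    hence "k ^ (2 * j) mod 4 = 1" by (rule odd_power_even_mod_4) simp
    hence "(k * k ^ (2 * j)) mod 4 = (3 * 1) mod 4" using k3 by (metis mod_mult_eq)
    thus ?thesis by (simp add: j)
  qed
  have par: "even x \<longleftrightarrow> even y"
    using odd3[OF mod4[OF assms(1,3)], of x] odd3[OF mod4[OF assms(2,4)], of y]
      odd_power_even_mod_4[OF o(1), of x] odd_power_even_mod_4[OF o(2), of y] less.prems(1)
    by (cases "even x"; cases "even y") simp_all
  show ?case
  proof (cases "even x")
    case True
    then obtain i j where ij: "x = 2 * i" "y = 2 * j" using par by (metis evenE)
    have "(a ^ i) ^ 2 = (b ^ j) ^ 2" using less.prems(1) by (simp add: ij power_mult[symmetric] mult.commute)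
    hence "a ^ i = b ^ j" by (simp add: power2_eq_iff_nonneg)
    thus ?thesis using less.IH[of i j] less.prems(2) ij by simp
  next
    case False
    have ab: "a > 0" "b > 0" using o by (auto elim!: oddE)
    have "multiplicity 2 (a ^ x + 1 ^ x) = multiplicity 2 (a + 1) + multiplicity 2 x"
      using o False ab by (intro multiplicity_power_sum_nat) simp_all
    moreover have "multiplicity 2 (b ^ y + 1 ^ y) = multiplicity 2 (b + 1) + multiplicity 2 y"
      using o False par ab by (intro multiplicity_power_sum_nat) simp_all
    moreover have "multiplicity 2 (a + 1) = m" "multiplicity 2 (b + 1) = n"
      unfolding assms(1,2) by simp_all
    ultimately have "m = n" using False par less.prems(1) by (simp add: not_dvd_imp_multiplicity_0)
    thus ?thesis using assms(1,2) by simp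
  qed
qed

text \<open>This situation arises when one solution starts a gap-one pair and, with \<open>a\<close>
  and \<open>b\<close> exchanged, also a gap-two pair. Valuations at 2 give k + w at most 2 + v(k),
  whence \<open>k = 2\<close>, \<open>w = 1\<close> and \<open>b = 2\<close>; the odd number
  \<open>a ^ x\<close> would then be a power of 2.\<close>

lemma no_power_gap_three_one:
  fixes a b k w x y :: nat
  assumes "odd a" "a > 1" "x > 0" "y > 0" "b ^ y = 2 * a ^ x"
    and "even k" "k > 0" "w > 0" "2 ^ k * b ^ w + 1 = 3 ^ k"
  shows False
proof -
  have eb: "even b" using assms(5,4) by (metis dvd_triv_left even_power)
  have "b ^ y > 0" using assms(2,5) by simp
  hence b0: "b > 0" using assms(4) by (cases b) simp_all
  have "(1 + 2 :: nat) = 3" by simp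
  hence eq: "(1 + 2) ^ k - 1 ^ k = 2 ^ k * b ^ w"
    using assms(9) by (metis add_diff_cancel_right' power_one)
  have "multiplicity 2 (2 ^ k * b ^ w) = multiplicity 2 (2 * 1 + 2 :: nat) + multiplicity 2 k"
    unfolding eq[symmetric] by (rule multiplicity_even_power_gap_two) (use assms in simp_all)
  moreover have "multiplicity 2 (2 * 1 + 2 :: nat) = 2" using multiplicity_prime_power[of "2::nat" 2] by simp
  moreover have "multiplicity 2 (2 ^ k * b ^ w) = k + w * multiplicity 2 b"
    using multiplicity_power_mult[of 2 2 "b ^ w" k] b0
    by (simp add: prime_elem_multiplicity_power_distrib)
  moreover have "multiplicity 2 b \<ge> 1" using eb b0 by (simp add: Suc_le_eq prime_multiplicity_gt_zero_iff)
  hence wb: "w \<le> w * multiplicity 2 b" by simp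
  ultimately have le: "k + w \<le> 2 + multiplicity 2 k" by linarith
  have k2: "2 ^ multiplicity 2 k \<le> k" using assms by (intro dvd_imp_le multiplicity_dvd)
  have "multiplicity 2 k < 2"
  proof (rule ccontr)
    assume "\<not> multiplicity 2 k < 2"
    hence "multiplicity 2 k \<ge> 2" by simp
    moreover have "v + 2 \<le> 2 ^ v" if "v \<ge> 2" for v :: nat
      using that by (induction v rule: dec_induct) auto
    ultimately show False using k2 le assms(8) by fastforce
  qed
  hence "k + w \<le> 3" using le by linarith
  hence "k = 2 \<and> w = 1" using assms(6-8) by (auto elim!: evenE)
  hence "b = 2" using assms(9) by simp
  hence "a ^ x dvd 2 ^ y" using assms(5) by (metis dvd_triv_right)
  then obtain i where i: "a ^ x = 2 ^ i" using divides_primepow_nat[of 2 "a ^ x" y] by auto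
  have "odd (a ^ x)" using assms(1) by simp
  hence "i = 0" using i by (cases i) simp_all
  thus False using i assms(2,3) by simp
qed

section \<open>Third solutions after removal of powers of 2\<close>

lemma multiple_if_mersenne_dvd:
  assumes "(2::nat) ^ H - 1 dvd 2 ^ z - 1" "H \<ge> 1"
  shows "H dvd z"
proof -
  define r where "r = z mod H"
  have rH: "r < H" using assms(2) by (simp add: r_def)
  have z: "z = H * (z div H) + r" by (simp add: r_def)
  let ?M = "(2::nat) ^ H - 1"
  have "[2 ^ H = 1] (mod ?M)" by (simp add: cong_altdef_nat)
  hence "[(2 ^ H) ^ (z div H) * 2 ^ r = 1 ^ (z div H) * 2 ^ r] (mod ?M)"
    by (intro cong_scalar_right cong_pow)
  hence "[2 ^ z = 2 ^ r] (mod ?M)"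
    by (simp only: power_mult[symmetric] power_add[symmetric] z[symmetric] power_one mult_1)
  moreover have "[2 ^ z = 1] (mod ?M)" using assms(1) by (simp add: cong_altdef_nat)
  ultimately have "[2 ^ r = 1] (mod ?M)" by (metis cong_sym cong_trans)
  hence "?M dvd 2 ^ r - 1" by (simp add: cong_altdef_nat)
  moreover have "(2::nat) ^ r < 2 ^ H" using rH by simp
  ultimately have "(2::nat) ^ r - 1 = 0" by (meson diff_less_mono nat_dvd_not_less not_gr_zero one_le_numeral one_le_power)
  hence "r = 0" using less_exp[of r] by linarith
  thus ?thesis by (simp add: r_def mod_eq_0_iff_dvd)
qed

text \<open>Modulo \<open>2 ^ H - 1\<close> the base \<open>2 ^ H + 1\<close> is 2, so
  \<open>2 ^ z\<close> is 1 there and \<open>H\<close> divides \<open>z\<close>. Lifting then forces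
  \<open>z = H\<close>, and a direct estimate finishes.\<close>

lemma no_unit_gap_power:
  fixes H T y z :: nat
  assumes H: "H \<ge> 2" and yz: "z < y" "z > 0" and T: "T > 0"
    and eq: "(2 ^ H + 1) ^ z = (1::nat) + 2 ^ T * (2 ^ H - 1) ^ y"
  shows False
proof -
  define b c :: nat where "b = 2 ^ H - 1" and "c = 2 ^ H + 1"
  have H4: "(4::nat) dvd 2 ^ H" using le_imp_power_dvd[OF H, of 2] by simp
  have H4': "(2::nat) ^ H \<ge> 4" using H4 by (intro dvd_imp_le) simp_all
  have b: "b \<ge> 3" "c = b + 2" using H4' by (simp_all add: b_def c_def)
  have eq: "c ^ z = 1 + 2 ^ T * b ^ y" using eq by (simp add: b_def c_def)
  have cb: "[c = 2] (mod b)" unfolding b(2) cong_def by (rule mod_add_self1)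
  have "b dvd c ^ z - 1" using eq yz by simp
  hence "[c ^ z = 1] (mod b)" using b by (simp add: cong_altdef_nat)
  hence "[2 ^ z = 1] (mod b)" using cong_pow[OF cb, of z] by (metis cong_sym cong_trans)
  hence "b dvd 2 ^ z - 1" by (simp add: cong_altdef_nat)
  hence "2 ^ H - 1 dvd 2 ^ z - (1::nat)" by (simp only: b_def)
  hence "H dvd z" by (rule multiple_if_mersenne_dvd) (use H in linarith)
  then obtain m where m: "z = H * m" by auto
  have m0: "m > 0" using m yz by (cases m) auto
  \<comment> \<open>\<open>X\<close> is 1 modulo \<open>b\<close> and modulo \<open>2 ^ H\<close>,
    hence modulo 4 and modulo every prime of \<open>2 ^ T * b ^ y = X ^ m - 1\<close>; so lifting
    applies at each of these primes.\<close>
  define X where "X = c ^ H"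
  have c1: "c > 1" using b by simp
  have X1: "X > 1" using c1 H unfolding X_def by (intro one_less_power) simp_all
  have Xm: "X ^ m - 1 = 2 ^ T * b ^ y" using eq by (simp add: X_def m power_mult)
  have bX: "b dvd X - 1"
  proof -
    have "[X = 2 ^ H] (mod b)" unfolding X_def by (rule cong_pow[OF cb])
    moreover have "[2 ^ H = 1] (mod b)" by (simp add: b_def cong_altdef_nat)
    ultimately have "[X = 1] (mod b)" by (rule cong_trans)
    thus ?thesis using X1 by (simp add: cong_altdef_nat)
  qed
  have cX: "2 ^ H dvd X - 1"
  proof -
    have "c - 1 dvd c ^ H - 1 ^ H" using c1 by (intro diff_dvd_power_diff_nat) simp
    thus ?thesis by (simp add: X_def c_def)
  qed
  have "X ^ m - 1 ^ m dvd (X - 1) * m"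
  proof (rule multiplicity_le_imp_dvd)
    fix r :: nat assume r: "prime r"
    show "multiplicity r (X ^ m - 1 ^ m) \<le> multiplicity r ((X - 1) * m)"
    proof (cases "r dvd X ^ m - 1 ^ m")
      case True
      hence "r dvd 2 ^ T * b ^ y" using Xm by simp
      hence "r dvd 2 ^ T \<or> r dvd b ^ y" using r by (simp add: prime_dvd_mult_iff)
      hence "r dvd 2 \<or> r dvd b" using r prime_dvd_power by blast
      moreover have "2 dvd X - 1" using cX H4 by (meson dvd_trans even_numeral)
      ultimately have "r dvd X - 1" using bX by (meson dvd_trans)
      moreover have "4 dvd X - 1" using cX H4 by (rule dvd_trans[rotated])
      moreover have "\<not> r dvd 1" using r by (metis not_prime_unit)
      ultimately have "multiplicity r (X ^ m - 1 ^ m) = multiplicity r (X - 1) + multiplicity r m"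
        using r X1 m0 by (intro multiplicity_power_diff_nat)
      also have "\<dots> = multiplicity r ((X - 1) * m)"
        using r X1 m0 by (subst prime_elem_multiplicity_mult_distrib) simp_all
      finally show ?thesis by simp
    qed (simp add: not_dvd_imp_multiplicity_0)
  qed (use Xm b in simp)
  hence "X ^ m - 1 ^ m \<le> (X - 1) * m" using X1 m0 by (intro dvd_imp_le) simp_all
  moreover have "(X - 1) * m < X ^ m - 1 ^ m" if "m \<ge> 2" using X1 that by (intro power_diff_gt) simp_all
  ultimately have "m = 1" using m0 by linarith
  hence zH: "z = H" using m by simp
  have ob: "odd b" using H by (simp add: b_def)
  have "2 ^ H dvd b ^ y * 2 ^ T" using cX Xm \<open>m = 1\<close> by (simp add: mult.commute)
  moreover have "coprime (2 ^ H) (b ^ y)" using ob by simp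
  ultimately have "(2::nat) ^ H dvd 2 ^ T" by (simp add: coprime_dvd_mult_right_iff)
  hence HT: "H \<le> T" by (rule power_dvd_imp_le) simp
  \<comment> \<open>\<open>c \<le> 2 * b\<close>, \<open>H \<le> T\<close> and
    \<open>z = H < y\<close> bound the left side of \<open>eq\<close> by
    \<open>2 ^ T * b ^ y\<close>, which it exceeds by 1.\<close>
  have "c ^ H \<le> (2 * b) ^ H" using b by (intro power_mono) simp_all
  also have "\<dots> = 2 ^ H * b ^ H" by (simp add: power_mult_distrib)
  also have "\<dots> \<le> 2 ^ T * b ^ y" using HT yz zH b by (intro mult_le_mono power_increasing) simp_all
  finally show False using eq zH by simp
qed

text \<open>\<open>b0\<close> and \<open>c0\<close> are the cofactors of \<open>2 ^ \<beta>\<close>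
  in \<open>b\<close> and \<open>2 ^ \<gamma>\<close> in \<open>c\<close>. The first solution reads
  2*2^U + 2^U*(2^H - 1) = 2^U*(2^H + 1); the third has been divided by
  \<open>2 ^ (\<gamma> * z3)\<close>, which turns the power of \<open>a\<close> into 1. The
  survivors are 3 = 1 + 2 and 9 = 1 + 8.\<close>

lemma pow2_family_third_solution:
  fixes b0 c0 H T U \<beta> \<gamma> y1 z1 y3 z3 :: nat
  assumes "H \<ge> 1" "y1 > 0" "z1 > 0" "y3 > 0" "z3 > 0" "T > 0" "U > 0"
    and b: "b0 ^ y1 + 1 = 2 ^ H" and c: "c0 ^ z1 = 2 ^ H + 1" and 3: "c0 ^ z3 = 1 + 2 ^ T * b0 ^ y3"
    and U: "\<beta> * y1 = U" "\<gamma> * z1 = U" "\<beta> * y3 = \<gamma> * z3 + T"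
  shows "b0 = 1 \<and> \<gamma> = U \<and> H = 1 \<and> (z3 = 1 \<and> T = 1 \<or> z3 = 2 \<and> T = 3)"
proof (cases "H = 1")
  case True
  hence "b0 ^ y1 = 1" using b by simp
  hence b0: "b0 = 1" using assms(2) by simp
  have c3: "c0 ^ z1 = 3" using c True by simp
  hence z1: "z1 = 1" using pow2_minus_one_not_perfect_power[of c0 z1 2] by simp
  hence c0: "c0 = 3" using c3 by simp
  have "3 ^ z3 = 2 ^ T + (1::nat)" using 3 by (simp add: b0 c0)
  with pow2_plus_one_perfect_power[of 3 z3 T] assms have "z3 = 1 \<or> z3 = 2 \<and> T = 3" by simp
  moreover have "T = 1" if "z3 = 1"
  proof -
    have "2 ^ T = (2::nat) ^ 1" using 3 that by (simp add: b0 c0)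
    thus ?thesis by (rule power_inject_exp[THEN iffD1, rotated]) simp
  qed
  ultimately show ?thesis using True b0 U z1 by auto
next
  case False
  hence H: "H \<ge> 2" using assms by simp
  have y1: "y1 = 1" using pow2_minus_one_not_perfect_power[OF b H] .
  hence b0: "b0 = 2 ^ H - 1" using b by simp
  consider "z1 = 1" | "c0 = 3" "H = 3" "z1 = 2" using pow2_plus_one_perfect_power[OF c] assms by auto
  hence False
  proof cases
    case 1
    hence c0: "c0 = 2 ^ H + 1" using c by simp
    have "\<beta> = U" "\<gamma> = U" using U y1 1 by simp_all
    hence "U * z3 < U * y3" using U(3) assms by simp
    hence "z3 < y3" by simp
    thus False by (rule no_unit_gap_power[OF H _ assms(5,6) 3[unfolded b0 c0]])
  next
    case 2
    hence b7: "b0 = 7" using b0 by simp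
    \<comment> \<open>The order of 3 modulo 7 is 6, so 6 divides \<open>z3\<close>. But 3^6 - 1 =
      2^3 * 7 * 13, and 13 cannot divide \<open>2 ^ T * 7 ^ y3\<close>.\<close>
    have eq: "3 ^ z3 = 1 + 2 ^ T * (7::nat) ^ y3" using 3 2 b7 by simp
    have m1: "(3::nat) ^ z3 mod 7 = 1"
    proof -
      have "(7::nat) dvd 2 ^ T * 7 ^ y3" using assms(4) by simp
      thus ?thesis unfolding eq by (auto simp: dvd_def)
    qed
    define q r where "q = z3 div 6" and "r = z3 mod 6"
    have z3: "z3 = 6 * q + r" by (simp add: q_def r_def)
    have "(3::nat) ^ z3 mod 7 = (((3 ^ 6) ^ q mod 7) * 3 ^ r) mod 7"
      by (simp only: z3 power_add power_mult mod_mult_left_eq)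
    also have "(3 ^ 6) ^ q mod 7 = (1::nat)"
      by (subst power_mod[symmetric]) simp
    finally have "(3::nat) ^ r mod 7 = 1" using m1 by simp
    moreover have "r < 6" by (simp add: r_def)
    hence "r = 0 \<or> r = 1 \<or> r = 2 \<or> r = 3 \<or> r = 4 \<or> r = 5" by auto
    ultimately have "r = 0" by auto
    hence "(3::nat) ^ z3 - 1 = (3 ^ 6) ^ q - 1 ^ q" using z3 by (simp only: power_mult power_one add_0_right)
    moreover have "(3::nat) ^ 6 - 1 dvd (3 ^ 6) ^ q - 1 ^ q" by (rule diff_dvd_power_diff_nat) simp
    moreover have "(13::nat) dvd 3 ^ 6 - 1" by simp
    ultimately have "13 dvd (3::nat) ^ z3 - 1" by (metis dvd_trans)
    hence "(13::nat) dvd 2 ^ T * 7 ^ y3" using eq by simp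
    moreover have p13: "prime (13::nat)" by simp
    ultimately have "(13::nat) dvd 2 ^ T \<or> (13::nat) dvd 7 ^ y3" using prime_dvd_mult_iff by blast
    hence "(13::nat) dvd 2 \<or> (13::nat) dvd 7" using p13 prime_dvd_power by blast
    thus False by (auto dest: dvd_imp_le)
  qed
  thus ?thesis ..
qed

section \<open>Pairs of solutions\<close>

text \<open>The smallest of the three valuations in a sum occurs at least twice; the types are the
  four ways in which this can happen.\<close>

lemma solution_type_cases:
  fixes a b c :: nat
  assumes "prime p" "a > 0" "b > 0" "c > 0" "a ^ x + b ^ y = c ^ z"
  shows "type_A p (a, b, c) (x, y, z) \<or> type_B p (a, b, c) (x, y, z) \<or>
    type_C p (a, b, c) (x, y, z) \<or> type_O p (a, b, c) (x, y, z)"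
proof -
  define u v w where "u = multiplicity p (a ^ x)" and "v = multiplicity p (b ^ y)"
    and "w = multiplicity p (c ^ z)"
  have e: "multiplicity p a * x = u" "multiplicity p b * y = v" "multiplicity p c * z = w"
    using assms by (simp_all add: u_def v_def w_def multiplicity_prime_power_nat)
  have "w = u" if "u < v"
    using multiplicity_sum_lt[of p "a ^ x" "b ^ y"] that assms by (simp add: u_def v_def w_def)
  moreover have "w = v" if "v < u"
    using multiplicity_sum_lt[of p "b ^ y" "a ^ x"] that assms
    by (simp add: u_def v_def w_def add.commute)
  moreover have "u \<le> w" if "u = v"
  proof -
    have "p ^ u dvd a ^ x" by (simp add: u_def multiplicity_dvd)
    moreover have "p ^ u dvd b ^ y" unfolding that by (simp add: v_def multiplicity_dvd)
    ultimately have "p ^ u dvd c ^ z" using assms(5) by (metis dvd_add)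
    thus ?thesis using assms unfolding w_def
      by (intro multiplicity_geI) (auto simp: prime_gt_Suc_0_nat)
  qed
  ultimately show ?thesis
    by (cases u v rule: linorder_cases) (auto simp: e order.order_iff_strict)
qed

text \<open>The last hypothesis says \<open>w \<le> \<delta> * (u - w)\<close>: the
  \<open>u - w\<close> surplus factors \<open>M\<close>, each at least \<open>2 ^ \<delta>\<close>,
  absorb \<open>2 ^ w\<close>.\<close>

lemma double_power_le:
  fixes M \<delta> u w :: nat
  assumes "2 ^ \<delta> \<le> M" "\<delta> > 0" "(\<delta> + 1) * w \<le> \<delta> * u"
  shows "(2 * M) ^ w \<le> M ^ u"
proof -
  have "\<delta> * w \<le> \<delta> * u" using assms(3) unfolding add_mult_distrib by linarith
  hence wu: "w \<le> u" using assms(2) by simp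
  have M: "M > 0" using assms(1) by (metis gr_zeroI le_zero_eq power_not_zero zero_neq_numeral)
  have "w \<le> \<delta> * (u - w)" using assms(3) by (simp add: algebra_simps)
  hence "(2::nat) ^ w \<le> 2 ^ (\<delta> * (u - w))" by simp
  also have "\<dots> \<le> M ^ (u - w)" using assms(1) by (simp add: power_mult power_mono)
  finally have "2 ^ w * M ^ w \<le> M ^ (u - w) * M ^ w" by simp
  thus ?thesis using wu by (simp add: power_mult_distrib power_add[symmetric])
qed

text \<open>With \<open>A = a ^ x1\<close>, \<open>B = b ^ y1\<close> and \<open>\<delta>\<close> their common \<open>p\<close>-adic valuation, both are at least
  \<open>2 ^ \<delta>\<close> while \<open>A + B\<close> is at most twice the larger one; the valuations force the second
  solution to outgrow this factor 2.\<close>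

lemma no_type_C_and_type_A:
  fixes a b c :: nat
  assumes p: "prime p" "p dvd a" and gt: "a > 1" "b > 1" "c > 1"
    and 1: "a ^ x1 + b ^ y1 = c ^ z1" "type_C p (a, b, c) (x1, y1, z1)" "x1 > 0" "y1 > 0" "z1 > 0"
    and 2: "a ^ x2 + b ^ y2 = c ^ z2" "type_A p (a, b, c) (x2, y2, z2)"
  shows False
proof -
  define \<alpha> \<beta> \<gamma> \<delta> where "\<alpha> = multiplicity p a" and "\<beta> = multiplicity p b" and "\<gamma> = multiplicity p c"
    and "\<delta> = \<alpha> * x1"
  have t1: "\<alpha> * x1 = \<delta>" "\<beta> * y1 = \<delta>" "\<delta> + 1 \<le> \<gamma> * z1"
    using 1(2) by (simp_all add: \<alpha>_def \<beta>_def \<gamma>_def \<delta>_def)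
  have t2: "\<beta> * y2 \<le> \<alpha> * x2" "\<beta> * y2 = \<gamma> * z2"
    using 2(2) by (simp_all add: \<alpha>_def \<beta>_def \<gamma>_def)
  have "\<alpha> > 0" using p gt by (simp add: \<alpha>_def prime_multiplicity_gt_zero_iff)
  hence d0: "\<delta> > 0" using 1(3) by (simp add: \<delta>_def)
  have big: "2 ^ \<delta> \<le> m ^ k" if "multiplicity p m * k = \<delta>" "m > 1" for m k
  proof -
    have "multiplicity p (m ^ k) = \<delta>" using that p by (simp add: multiplicity_prime_power_nat)
    hence "p ^ \<delta> dvd m ^ k" by (metis multiplicity_dvd)
    hence "p ^ \<delta> \<le> m ^ k" using that by (intro dvd_imp_le) simp_all
    moreover have "2 ^ \<delta> \<le> p ^ \<delta>" using p by (intro power_mono) (simp_all add: prime_ge_2_nat)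
    ultimately show ?thesis by simp
  qed
  \<comment> \<open>\<open>m\<close> is whichever of \<open>a\<close> and \<open>b\<close> gives the
    larger term of the first solution. The exponents \<open>k1 * z2\<close> and
    \<open>k1 * z1\<close> are chosen so that both equations reach the same power of
    \<open>c\<close>.\<close>
  have c_le: False
    if m: "multiplicity p m * k1 = \<delta>" "m > 1" "c ^ z1 \<le> 2 * m ^ k1" "m ^ k2 < c ^ z2"
      "\<gamma> * z2 \<le> multiplicity p m * k2" "k1 > 0" for m k1 k2
  proof -
    have "(\<delta> + 1) * (k1 * z2) \<le> (\<gamma> * z1) * (k1 * z2)" using t1(3) by (intro mult_le_mono1)
    also have "\<dots> = (k1 * z1) * (\<gamma> * z2)" by (simp add: algebra_simps)
    also have "\<dots> \<le> (k1 * z1) * (multiplicity p m * k2)" using m(5) by (intro mult_le_mono2)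
    also have "\<dots> = \<delta> * (k2 * z1)" unfolding m(1)[symmetric] by (simp add: algebra_simps)
    finally have "(2 * m ^ k1) ^ (k1 * z2) \<le> (m ^ k1) ^ (k2 * z1)"
      using big[OF m(1,2)] d0 by (intro double_power_le)
    also have "\<dots> = (m ^ k2) ^ (k1 * z1)" by (simp add: power_mult[symmetric] algebra_simps)
    also have "\<dots> < (c ^ z2) ^ (k1 * z1)" using m(4,6) 1(5) by (intro power_strict_mono) simp_all
    also have "\<dots> = (c ^ z1) ^ (k1 * z2)" by (simp add: power_mult[symmetric] algebra_simps)
    also have "\<dots> \<le> (2 * m ^ k1) ^ (k1 * z2)" using m(3) by (intro power_mono) simp_all
    finally show False by simp
  qed
  have lt: "a ^ x2 < c ^ z2" "b ^ y2 < c ^ z2" using 2(1) gt by (metis add.commute less_add_same_cancel1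
        less_trans zero_less_one zero_less_power)+
  show False
  proof (cases "b ^ y1 \<le> a ^ x1")
    case True
    hence "c ^ z1 \<le> 2 * a ^ x1" using 1(1) by simp
    thus False using c_le[of a x1 x2] t1 t2 gt lt 1(3) by (simp add: \<alpha>_def)
  next
    case False
    hence "c ^ z1 \<le> 2 * b ^ y1" using 1(1) by simp
    thus False using c_le[of b y1 y2] t1 t2 gt lt 1(4) by (simp add: \<beta>_def)
  qed
qed

section \<open>Proportional exponents and gap pairs\<close>

lemma proportional_pairs:
  fixes y1 y2 z1 z2 :: nat
  assumes "y1 * z2 = y2 * z1" "y1 > 0" "y2 > 0"
  shows "\<exists>m n h k. coprime m n \<and> m > 0 \<and> n > 0 \<and> h > 0 \<and>
    y1 = m * h \<and> y2 = n * h \<and> z1 = m * k \<and> z2 = n * k"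
proof -
  obtain h m n where h: "h > 0" and mn: "y1 = h * m" "y2 = h * n" "coprime m n"
    using coprime_decomposition[OF assms(2)] by blast
  have m0: "m > 0" "n > 0" using mn assms by (cases m; cases n; simp)+
  have eq: "m * z2 = n * z1" using assms(1) h by (simp add: mn)
  hence "m dvd n * z1" by (metis dvd_triv_left)
  hence "m dvd z1" using mn(3) by (simp add: coprime_dvd_mult_right_iff)
  then obtain k where k: "z1 = m * k" by auto
  hence "z2 = n * k" using eq m0 by simp
  thus ?thesis using k mn m0 h by (intro exI[of _ m] exI[of _ n] exI[of _ h] exI[of _ k]) (simp add: mult.commute)
qed

text \<open>Writing \<open>b ^ y1 = D * e\<close> and \<open>c ^ z1 = D * f\<close> with coprime \<open>e\<close> and \<open>f\<close>, the gap is \<open>f - e\<close>.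
  Gap one leads to family (iii), gap two to families (i) and (iv).\<close>

definition gap_one_pair :: "triple \<Rightarrow> triple \<Rightarrow> triple \<Rightarrow> bool" where
  "gap_one_pair = (\<lambda>(a, b, c) (x1, y1, z1) (x2, y2, z2). \<exists>n e w. n \<ge> 2 \<and> e > 0 \<and> w > 0 \<and>
    x2 = n * x1 + w \<and> y2 = n * y1 \<and> z2 = n * z1 \<and>
    b ^ y1 = a ^ x1 * e \<and> c ^ z1 = a ^ x1 * (e + 1) \<and> a ^ w + e ^ n = (e + 1) ^ n)"

definition gap_two_pair :: "triple \<Rightarrow> triple \<Rightarrow> triple \<Rightarrow> bool" where
  "gap_two_pair = (\<lambda>(a, b, c) (x1, y1, z1) (x2, y2, z2). \<exists>n e w D. n \<ge> 2 \<and> even n \<and> odd e \<and> w > 0 \<and>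
    x2 = n * x1 + w \<and> y2 = n * y1 \<and> z2 = n * z1 \<and>
    a ^ x1 = 2 * D \<and> b ^ y1 = D * e \<and> c ^ z1 = D * (e + 2) \<and> 2 ^ n * a ^ w + e ^ n = (e + 2) ^ n)"

definition gap_pair :: "triple \<Rightarrow> triple \<Rightarrow> triple \<Rightarrow> bool" where
  "gap_pair t s1 s2 \<longleftrightarrow> gap_one_pair t s1 s2 \<or> gap_two_pair t s1 s2"

text \<open>The classification of power differences is applied to the bases \<open>b ^ h\<close> and
  \<open>c ^ k\<close>. Since it yields \<open>m = 1\<close>, the second solution multiplies both
  \<open>y\<close> and \<open>z\<close> of the first by \<open>n\<close>.\<close>

lemma gap_pair_of_power_differences:
  fixes a b c :: nat
  assumes gt: "a > 1" "b > 1" "c > 1" and mn: "0 < m" "m < n" "coprime m n" "h > 0"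
    and 1: "a ^ x1 + b ^ (m * h) = c ^ (m * k)" and 2: "a ^ x2 + b ^ (n * h) = c ^ (n * k)"
  shows "gap_pair (a, b, c) (x1, m * h, m * k) (x2, n * h, n * k)"
proof -
  have r1: "a ^ x1 + (b ^ h) ^ m = (c ^ k) ^ m" and r2: "a ^ x2 + (b ^ h) ^ n = (c ^ k) ^ n"
    using 1 2 by (simp_all add: power_mult[symmetric] mult.commute)
  have "b ^ h > 0" using gt by simp
  from power_difference_pair[OF gt(1) this mn(1-3) r1 r2] obtain D e f where m1: "m = 1"
    and nx: "n * x1 < x2" and ef: "b ^ h = D * e" "c ^ k = D * f" "coprime e f"
    and f: "f = e + 1 \<or> f = e + 2 \<and> odd e \<and> even n" by blast
  have D0: "D > 0" and e0: "e > 0" using \<open>b ^ h > 0\<close> ef(1) by (cases D; cases e; simp)+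
  obtain w where w: "x2 = n * x1 + w" "w > 0" using nx less_imp_add_positive by metis
  have n2: "n \<ge> 2" using mn m1 by simp
  have a1: "a ^ x1 + D * e = D * f" using r1 m1 ef by simp
  \<comment> \<open>Splitting \<open>a ^ x2\<close> in this way lets
    \<open>a ^ x1 = (f - e) * D\<close> cancel \<open>D ^ n\<close>. For gap two the leftover
    \<open>(f - e) ^ n\<close> is the factor \<open>2 ^ n\<close> in
    \<open>gap_two_pair\<close>.\<close>
  have a2: "(a ^ x1) ^ n * a ^ w + D ^ n * e ^ n = D ^ n * f ^ n"
  proof -
    have "a ^ x2 = (a ^ x1) ^ n * a ^ w" by (simp add: w power_add power_mult[symmetric] mult.commute)
    thus ?thesis using r2 by (simp only: ef power_mult_distrib)
  qed
  from f show ?thesis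
  proof
    assume f1: "f = e + 1"
    have ax: "a ^ x1 = D" using a1 f1 by simp
    have "D ^ n * (a ^ w + e ^ n) = D ^ n * (e + 1) ^ n" using a2 by (simp add: ax f1 algebra_simps)
    hence "a ^ w + e ^ n = (e + 1) ^ n" using D0 by simp
    hence "gap_one_pair (a, b, c) (x1, m * h, m * k) (x2, n * h, n * k)"
      unfolding gap_one_pair_def using n2 e0 w ax ef m1 f1 by auto
    thus ?thesis by (simp add: gap_pair_def)
  next
    assume f2: "f = e + 2 \<and> odd e \<and> even n"
    have ax: "a ^ x1 = 2 * D" using a1 f2 by simp
    have "D ^ n * (2 ^ n * a ^ w + e ^ n) = D ^ n * (e + 2) ^ n"
      using a2 f2 by (simp add: ax algebra_simps power_mult_distrib)
    hence "2 ^ n * a ^ w + e ^ n = (e + 2) ^ n" using D0 by simp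
    hence "gap_two_pair (a, b, c) (x1, m * h, m * k) (x2, n * h, n * k)"
      unfolding gap_two_pair_def using n2 f2 w ax ef m1 by auto
    thus ?thesis by (simp add: gap_pair_def)
  qed
qed

text \<open>Hypothesis \<open>t\<close> is what types A and O have in common, and with
  \<open>a\<close> and \<open>b\<close> exchanged it serves types B and O. Which solution is the
  smaller multiple is not known, hence the disjunction.\<close>

lemma gap_pair_if_proportional:
  fixes a b c :: nat
  assumes gt: "a > 1" "b > 1" "c > 1" and p: "prime p" "p dvd b" "p dvd c"
    and 1: "is_solution (a, b, c) (x1, y1, z1)" and 2: "is_solution (a, b, c) (x2, y2, z2)"
    and t: "multiplicity p b * y1 = multiplicity p c * z1" "multiplicity p b * y2 = multiplicity p c * z2"
    and ne: "(x1, y1, z1) \<noteq> (x2, y2, z2)"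
  shows "gap_pair (a, b, c) (x1, y1, z1) (x2, y2, z2) \<or> gap_pair (a, b, c) (x2, y2, z2) (x1, y1, z1)"
proof -
  have v: "multiplicity p b > 0" "multiplicity p c > 0" using p gt by (simp_all add: prime_multiplicity_gt_zero_iff)
  have "(multiplicity p b * multiplicity p c) * (y1 * z2) = (multiplicity p b * y1) * (multiplicity p c * z2)"
    by (simp add: algebra_simps)
  also have "\<dots> = (multiplicity p c * z1) * (multiplicity p b * y2)" by (simp only: t)
  also have "\<dots> = (multiplicity p b * multiplicity p c) * (y2 * z1)" by (simp add: algebra_simps)
  finally have "y1 * z2 = y2 * z1" using v by simp
  with 1 2 proportional_pairs[of y1 z2 y2 z1] obtain m n h k where mn: "coprime m n" "m > 0" "n > 0" "h > 0"
    "y1 = m * h" "y2 = n * h" "z1 = m * k" "z2 = n * k" by auto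
  have "m \<noteq> n"
  proof
    assume mn': "m = n"
    have "a ^ x1 = a ^ x2" using 1 2 mn mn' by simp
    hence "x1 = x2" using gt by simp
    thus False using ne mn mn' by simp
  qed
  thus ?thesis
    using gap_pair_of_power_differences[OF gt, of m n h x1 k x2] gap_pair_of_power_differences[OF gt, of n m h x2 k x1]
      mn 1 2 by (cases "m < n") (auto simp: coprime_commute)
qed

section \<open>Third solutions\<close>

lemma gcd_power_common_factor:
  fixes D e f :: nat
  assumes "B = D * e" "C = D * f" "coprime e f"
  shows "gcd (B ^ n) (C ^ n) = D ^ n"
proof -
  have "gcd (B ^ n) (C ^ n) = D ^ n * gcd (e ^ n) (f ^ n)"
    by (simp only: assms power_mult_distrib gcd_mult_distrib_nat)
  moreover have "gcd (e ^ n) (f ^ n) = 1" using assms(3) by simp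
  ultimately show ?thesis by simp
qed

lemma coprime_add_two: "odd (e::nat) \<Longrightarrow> coprime e (e + 2)"
  by (metis add.commute coprime_add_one_right coprime_commute coprime_left_2_iff_odd coprime_mult_self_right_iff gcd_add2 coprime_iff_gcd_eq_1)

lemma gap_pair_exponents:
  assumes "gap_pair (a, b, c) (x1, y1, z1) (x2, y2, z2)"
  shows "\<exists>n\<ge>2. n * x1 < x2 \<and> y2 = n * y1 \<and> z2 = n * z1"
  using assms unfolding gap_pair_def gap_one_pair_def gap_two_pair_def by auto

text \<open>The first member of a gap pair satisfies an inequality that the second one violates, so
  no three solutions can be pairwise related by gap pairs.\<close>

lemma gap_pair_gcd:
  fixes a b c :: nat
  assumes "gap_pair (a, b, c) (x1, y1, z1) (x2, y2, z2)" "a > 1"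
  shows "a ^ x1 \<le> 2 * gcd (b ^ y1) (c ^ z1)" "\<not> a ^ x2 \<le> 2 * gcd (b ^ y2) (c ^ z2)"
proof -
  obtain n e f w D where n: "n \<ge> 2" "f > e" "e > 0" "coprime e f"
    and s2: "x2 = n * x1 + w" "y2 = n * y1" "z2 = n * z1"
    and D: "a ^ x1 = (f - e) * D" "f - e \<le> 2" "b ^ y1 = D * e" "c ^ z1 = D * f"
    and w: "(f - e) ^ n * a ^ w + e ^ n = f ^ n"
  proof (cases "gap_one_pair (a, b, c) (x1, y1, z1) (x2, y2, z2)")
    case True
    then obtain n e w where "n \<ge> 2" "e > 0" "x2 = n * x1 + w" "y2 = n * y1" "z2 = n * z1"
      "b ^ y1 = a ^ x1 * e" "c ^ z1 = a ^ x1 * (e + 1)" "a ^ w + e ^ n = (e + 1) ^ n"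
      unfolding gap_one_pair_def by auto
    thus ?thesis using that[of n e "e + 1" w "a ^ x1"] by simp
  next
    case False
    hence "gap_two_pair (a, b, c) (x1, y1, z1) (x2, y2, z2)" using assms by (simp add: gap_pair_def)
    then obtain n e w D where "n \<ge> 2" "odd e" "x2 = n * x1 + w" "y2 = n * y1" "z2 = n * z1"
      "a ^ x1 = 2 * D" "b ^ y1 = D * e" "c ^ z1 = D * (e + 2)" "2 ^ n * a ^ w + e ^ n = (e + 2) ^ n"
      unfolding gap_two_pair_def by auto
    thus ?thesis using that[of n e "e + 2" w D] coprime_add_two[of e] odd_pos[of e] by simp
  qed
  have "gcd (b ^ y1) (c ^ z1) = D" using gcd_power_common_factor[OF D(3,4) n(4), of 1] by simp
  thus "a ^ x1 \<le> 2 * gcd (b ^ y1) (c ^ z1)" using D by simp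
  have "gcd (b ^ y2) (c ^ z2) = D ^ n"
    using gcd_power_common_factor[OF D(3,4) n(4), of n] by (simp add: s2 power_mult[symmetric] mult.commute)
  moreover have "a ^ x2 = (a ^ x1) ^ n * a ^ w" by (simp add: s2 power_add power_mult[symmetric] mult.commute)
  hence "a ^ x2 = D ^ n * ((f - e) ^ n * a ^ w)" by (simp add: D power_mult_distrib)
  \<comment> \<open>The product equals \<open>f ^ n - e ^ n\<close>, the cofactor of
    \<open>D ^ n\<close> in \<open>a ^ x2\<close>.\<close>
  moreover have "(f - e) ^ n * a ^ w > 2"
  proof -
    have "1 * 2 \<le> (f - e) * n" using n by (intro mult_le_mono) simp_all
    also have "\<dots> < f ^ n - e ^ n" using n by (intro power_diff_gt)
    finally show ?thesis using w by simp
  qed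
  moreover have "D > 0" using D(1) assms(2) by (cases D) auto
  ultimately show "\<not> a ^ x2 \<le> 2 * gcd (b ^ y2) (c ^ z2)" by (simp add: not_le)
qed

text \<open>Both pairs start at the same solution, so the two descriptions of \<open>a ^ x1\<close>
  and \<open>b ^ y1\<close> can be multiplied. Two gaps of one give \<open>e = d = 1\<close>, so
  \<open>a\<close> and \<open>b\<close> are numbers 2^n - 1 and 2^k - 1 with a common power, hence
  equal, and the third solution is the second with its summands exchanged. Mixed gaps lead to
  \<open>3 ^ k = 2 ^ k * b ^ v + 1\<close> with \<open>a\<close> odd (or the same with
  \<open>a\<close> and \<open>b\<close> exchanged), and two gaps of two make 4 a product of odd
  numbers.\<close>

lemma third_solution_type_O_B:
  fixes a b c :: nat
  assumes gt: "a > 1" "b > 1" and pos: "x1 > 0" "y1 > 0"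
    and P: "gap_pair (a, b, c) (x1, y1, z1) (x2, y2, z2)"
    and Q: "gap_pair (b, a, c) (y1, x1, z1) (y3, x3, z3)"
  shows "{a ^ x3, b ^ y3} = {a ^ x2, b ^ y2}"
proof -
  have pos': "a ^ x1 > 0" "b ^ y1 > 0" using gt by simp_all
  have no12: False if H: "a > 1" "x1 > 0" "y1 > 0"
    "gap_one_pair (a, b, c) (x1, y1, z1) s2" "gap_two_pair (b, a, c) (y1, x1, z1) s3"
    for a b x1 y1 s2 s3
  proof -
    obtain n e w where 1: "n \<ge> 2" "b ^ y1 = a ^ x1 * e" "w > 0" "a ^ w + e ^ n = (e + 1) ^ n"
      using H(4) unfolding gap_one_pair_def by (auto split: prod.splits)
    obtain k d v D where 2: "k \<ge> 2" "even k" "odd d" "v > 0" "b ^ y1 = 2 * D" "a ^ x1 = D * d"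
      "2 ^ k * b ^ v + d ^ k = (d + 2) ^ k"
      using H(5) unfolding gap_two_pair_def by (auto split: prod.splits)
    have D0: "D > 0" using 2(6) H(1) by (cases D) auto
    have "D * (d * e) = D * 2" using 1(2) 2(5,6) by (simp add: algebra_simps)
    hence de: "d * e = 2" using D0 by simp
    hence "d dvd 2" by (metis dvd_triv_left)
    hence "d \<le> 2" by (rule dvd_imp_le) simp
    hence d1: "d = 1" using 2(3) by (cases d) auto
    hence e2: "e = 2" using de by simp
    have "odd (a ^ w)"
    proof -
      have "even (e ^ n)" using 1(1) e2 by simp
      moreover have "odd ((e + 1) ^ n)" using e2 by simp
      ultimately show ?thesis using 1(4) by (metis even_add)
    qed
    hence "odd a" using 1(3) by simp
    thus False using no_power_gap_three_one[of a x1 y1 b k v] H(1-3) 2 d1 by (simp add: numeral_3_eq_3)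
  qed
  from P Q show ?thesis unfolding gap_pair_def
  proof (elim disjE)
    assume P: "gap_one_pair (a, b, c) (x1, y1, z1) (x2, y2, z2)"
      and Q: "gap_one_pair (b, a, c) (y1, x1, z1) (y3, x3, z3)"
    from P obtain n e w where 1: "n \<ge> 2" "w > 0" "x2 = n * x1 + w" "y2 = n * y1"
      "b ^ y1 = a ^ x1 * e" "a ^ w + e ^ n = (e + 1) ^ n"
      unfolding gap_one_pair_def prod.case by blast
    from Q obtain k d v where 2: "k \<ge> 2" "v > 0" "y3 = k * y1 + v" "x3 = k * x1"
      "a ^ x1 = b ^ y1 * d" "b ^ v + d ^ k = (d + 1) ^ k"
      unfolding gap_one_pair_def prod.case by blast
    have "a ^ x1 * (e * d) = (a ^ x1 * e) * d" by (simp only: mult.assoc)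
    also have "\<dots> = a ^ x1 * 1" by (simp only: 1(5)[symmetric] 2(5)[symmetric] mult_1_right)
    finally have "a ^ x1 * (e * d) = a ^ x1 * 1" .
    hence "e * d = 1" using pos' by (metis mult_left_cancel less_numeral_extra(3))
    hence e1: "e = 1" "d = 1" by simp_all
    have a: "a ^ w + 1 = 2 ^ n" and b: "b ^ v + 1 = 2 ^ k" using 1(6) 2(6) e1 by (simp_all add: numeral_2_eq_2)
    have "w = 1" "v = 1" using pow2_minus_one_not_perfect_power a b 1(1) 2(1) by blast+
    hence a1: "a + 1 = 2 ^ n" and b1: "b + 1 = 2 ^ k" using a b by simp_all
    have xy: "a ^ x1 = b ^ y1" using 1(5) e1 by simp
    have ab: "a = b" by (rule mersenne_powers_eq[OF a1 b1 1(1) 2(1) xy pos(1)])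
    hence "x1 = y1" using xy gt by simp
    moreover have "(2::nat) ^ n = 2 ^ k" using a1 b1 ab by simp
    hence "n = k" by simp
    ultimately show ?thesis using ab 1(3,4) 2(3,4) \<open>w = 1\<close> \<open>v = 1\<close> by auto
  next
    assume "gap_one_pair (a, b, c) (x1, y1, z1) (x2, y2, z2)" "gap_two_pair (b, a, c) (y1, x1, z1) (y3, x3, z3)"
    thus ?thesis using no12 gt pos by blast
  next
    assume "gap_two_pair (a, b, c) (x1, y1, z1) (x2, y2, z2)" "gap_one_pair (b, a, c) (y1, x1, z1) (y3, x3, z3)"
    thus ?thesis using no12 gt pos by blast
  next
    assume P: "gap_two_pair (a, b, c) (x1, y1, z1) (x2, y2, z2)"
      and Q: "gap_two_pair (b, a, c) (y1, x1, z1) (y3, x3, z3)"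
    from P obtain e D where 1: "odd e" "a ^ x1 = 2 * D" "b ^ y1 = D * e"
      unfolding gap_two_pair_def prod.case by blast
    from Q obtain d D' where 2: "odd d" "b ^ y1 = 2 * D'" "a ^ x1 = D' * d"
      unfolding gap_two_pair_def prod.case by blast
    have "D * D' * 4 = (2 * D) * (2 * D')" by simp
    also have "\<dots> = (D' * d) * (D * e)" by (simp only: 1(2)[symmetric] 1(3)[symmetric] 2(2)[symmetric] 2(3)[symmetric])
    also have "\<dots> = D * D' * (e * d)" by (simp only: mult.assoc mult.commute mult.left_commute)
    finally have "D * D' * 4 = D * D' * (e * d)" .
    moreover have "D > 0" "D' > 0" using pos' 1(2) 2(2) by simp_all
    ultimately have "4 = e * d" by simp
    hence "even (e * d)" by (metis even_numeral)
    thus ?thesis using 1(1) 2(1) by simp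
  qed
qed

text \<open>Gap one would make \<open>b ^ y1\<close> a multiple of \<open>a ^ x1\<close>, against
  type A. In gap two \<open>D\<close> divides both terms, so the larger valuation of
  \<open>a ^ x1\<close> comes from its extra factor 2 and \<open>p = 2\<close>. The third solution
  proves to be one of the known ones with its summands exchanged.\<close>

lemma third_solution_type_A_B:
  fixes a b c :: nat
  assumes gt: "a > 1" "b > 1" "c > 1" and p: "prime p" "p dvd a" "p dvd b" "p dvd c"
    and 1: "is_solution (a, b, c) (x1, y1, z1)" "type_A p (a, b, c) (x1, y1, z1)"
    and 3: "is_solution (a, b, c) (x3, y3, z3)" "type_B p (a, b, c) (x3, y3, z3)"
    and P: "gap_pair (a, b, c) (x1, y1, z1) (x2, y2, z2)"
  shows "{a ^ x3, b ^ y3} = {a ^ x1, b ^ y1} \<or> {a ^ x3, b ^ y3} = {a ^ x2, b ^ y2}"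
proof -
  have pos: "x1 > 0" "y1 > 0" "z1 > 0" "x3 > 0" "y3 > 0" "z3 > 0"
    and e3: "a ^ x3 + b ^ y3 = c ^ z3" using 1 3 by auto
  have vp: "multiplicity r (m ^ k) = multiplicity r m * k" if "prime r" "m > 1" for r m k :: nat
    using that by (simp add: multiplicity_prime_power_nat)
  have vm: "multiplicity r (i * j) = multiplicity r i + multiplicity r j"
    if "prime r" "i > 0" "j > 0" for r i j :: nat
    using that by (simp add: prime_elem_multiplicity_mult_distrib)
  have "\<not> gap_one_pair (a, b, c) (x1, y1, z1) (x2, y2, z2)"
  proof
    assume "gap_one_pair (a, b, c) (x1, y1, z1) (x2, y2, z2)"
    then obtain e where "e > 0" "b ^ y1 = a ^ x1 * e" unfolding gap_one_pair_def by auto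
    hence "multiplicity p (a ^ x1) \<le> multiplicity p (b ^ y1)"
      using gt by (intro dvd_imp_multiplicity_le) simp_all
    thus False using 1(2) p gt by (simp add: vp)
  qed
  with P obtain n e w D where n: "n \<ge> 2" "even n" "odd e" "w > 0" "x2 = n * x1 + w" "y2 = n * y1"
    and D: "a ^ x1 = 2 * D" "b ^ y1 = D * e" "c ^ z1 = D * (e + 2)"
    and w: "2 ^ n * a ^ w + e ^ n = (e + 2) ^ n"
    unfolding gap_pair_def gap_two_pair_def by auto
  have D0: "D > 0" using D(1) gt by (cases D) auto
  have e0: "e > 0" using n(3) by (simp add: odd_pos)
  have p2: "p = 2"
  proof (rule ccontr)
    assume "p \<noteq> 2"
    hence "\<not> p dvd 2" using p(1) by (metis primes_dvd_imp_eq two_is_prime_nat)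
    hence "multiplicity p (2 * D) = multiplicity p D"
      using p(1) D0 by (simp add: vm not_dvd_imp_multiplicity_0)
    also have "\<dots> \<le> multiplicity p (b ^ y1)"
      unfolding D(2) using D0 e0 by (intro dvd_imp_multiplicity_le) simp_all
    finally show False using 1(2) p gt by (simp add: vp D(1)[symmetric])
  qed
  define \<alpha> \<beta> \<gamma> where "\<alpha> = multiplicity 2 a" and "\<beta> = multiplicity 2 b" and "\<gamma> = multiplicity 2 c"
  have abc: "\<alpha> > 0" "\<beta> > 0" "\<gamma> > 0"
    using p gt p2 by (simp_all add: \<alpha>_def \<beta>_def \<gamma>_def prime_multiplicity_gt_zero_iff)
  have t1: "\<beta> * y1 < \<alpha> * x1" "\<beta> * y1 = \<gamma> * z1" and t3: "\<gamma> * z3 < \<beta> * y3" "\<alpha> * x3 = \<gamma> * z3"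
    using 1(2) 3(2) by (simp_all add: p2 \<alpha>_def \<beta>_def \<gamma>_def)
  \<comment> \<open>Together with \<open>Y\<close> this says x3/x1 < z3/z1 < y3/y1, a statement that
    no longer mentions \<open>p\<close>.\<close>
  have X: "x3 * z1 < z3 * x1"
  proof -
    have "(\<alpha> * \<gamma>) * (x3 * z1) = (\<alpha> * x3) * (\<gamma> * z1)" by (simp add: algebra_simps)
    also have "\<dots> = (\<gamma> * z3) * (\<beta> * y1)" by (simp only: t1(2) t3(2))
    also have "\<dots> < (\<gamma> * z3) * (\<alpha> * x1)" using t1(1) abc pos by simp
    also have "\<dots> = (\<alpha> * \<gamma>) * (z3 * x1)" by (simp add: algebra_simps)
    finally show ?thesis by simp
  qed
  have Y: "z3 * y1 < y3 * z1"
  proof -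
    have "(\<beta> * \<gamma>) * (z3 * y1) = (\<gamma> * z3) * (\<beta> * y1)" by (simp add: algebra_simps)
    also have "\<dots> < (\<beta> * y3) * (\<beta> * y1)" using t3(1) abc pos by simp
    also have "\<dots> = (\<beta> * y3) * (\<gamma> * z1)" by (simp only: t1(2))
    also have "\<dots> = (\<beta> * \<gamma>) * (y3 * z1)" by (simp add: algebra_simps)
    finally show ?thesis by simp
  qed
  \<comment> \<open>At an odd prime dividing \<open>a\<close> the first solution is type O, so there \<open>X\<close> and \<open>Y\<close> would make the
    three valuations of the third solution pairwise distinct.\<close>
  have only2: "q = 2" if q: "prime q" "q dvd a" for q
  proof (rule ccontr)
    assume "q \<noteq> 2"
    hence q2: "\<not> q dvd 2" using q(1) by (metis primes_dvd_imp_eq two_is_prime_nat)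
    have qa: "q dvd 2 ^ n * a ^ w" using q n(4) by (simp add: dvd_mult prime_dvd_power_iff)
    have qe: "\<not> q dvd e"
    proof
      assume "q dvd e"
      hence "q dvd e ^ n" using n(1) q(1) by (simp add: prime_dvd_power_iff)
      hence "q dvd (e + 2) ^ n" using qa w by (metis dvd_add)
      hence "q dvd e + 2" using q(1) prime_dvd_power by blast
      thus False using \<open>q dvd e\<close> q2 by (metis dvd_add_right_iff)
    qed
    have qf: "\<not> q dvd e + 2"
    proof
      assume qf: "q dvd e + 2"
      hence "q dvd (e + 2) ^ n" using n(1) q(1) by (simp add: prime_dvd_power_iff)
      hence "q dvd e ^ n" using qa w by (metis dvd_add_right_iff)
      hence "q dvd e" using q(1) prime_dvd_power by blast
      thus False using qe by simp
    qed
    define d where "d = multiplicity q D"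
    define \<alpha>' \<beta>' \<gamma>' where "\<alpha>' = multiplicity q a" and "\<beta>' = multiplicity q b" and "\<gamma>' = multiplicity q c"
    have "multiplicity q (a ^ x1) = d" "multiplicity q (b ^ y1) = d" "multiplicity q (c ^ z1) = d"
      unfolding D using q(1) q2 qe qf D0 e0 by (simp_all add: vm not_dvd_imp_multiplicity_0 d_def del: add_2_eq_Suc')
    hence d: "\<alpha>' * x1 = d" "\<beta>' * y1 = d" "\<gamma>' * z1 = d"
      using q gt by (simp_all add: vp \<alpha>'_def \<beta>'_def \<gamma>'_def)
    have "\<alpha>' > 0" using q gt by (simp add: \<alpha>'_def prime_multiplicity_gt_zero_iff)
    hence d0: "d > 0" unfolding d(1)[symmetric] using pos by simp
    have "\<alpha>' * x3 < \<gamma>' * z3"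
    proof -
      have "(x1 * z1) * (\<alpha>' * x3) = d * (x3 * z1)" by (simp add: d(1)[symmetric] algebra_simps)
      also have "\<dots> < d * (z3 * x1)" using X d0 by simp
      also have "\<dots> = (x1 * z1) * (\<gamma>' * z3)" by (simp add: d(3)[symmetric] algebra_simps)
      finally show ?thesis by simp
    qed
    moreover have "\<gamma>' * z3 < \<beta>' * y3"
    proof -
      have "(y1 * z1) * (\<gamma>' * z3) = d * (z3 * y1)" by (simp add: d(3)[symmetric] algebra_simps)
      also have "\<dots> < d * (y3 * z1)" using Y d0 by simp
      also have "\<dots> = (y1 * z1) * (\<beta>' * y3)" by (simp add: d(2)[symmetric] algebra_simps)
      finally show ?thesis by simp
    qed
    ultimately show False
      using solution_type_cases[of q a b c x3 y3 z3] q(1) gt e3 by (auto simp: \<alpha>'_def \<beta>'_def \<gamma>'_def)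
  qed
  obtain i where i: "a = 2 ^ i"
    using power_of_prime_if_unique_prime_factor[of a 2] only2 gt two_is_prime_nat by (metis less_trans zero_less_one)
  have "D dvd 2 ^ (i * x1)" using D(1) by (simp add: i power_mult[symmetric])
  then obtain U where U: "D = 2 ^ U" using divides_primepow_nat[of 2 D] by auto
  have \<beta>U: "\<beta> * y1 = U" and \<gamma>U: "\<gamma> * z1 = U"
  proof -
    have "multiplicity 2 (b ^ y1) = U" unfolding D(2) U using n(3) e0 by (simp add: vm not_dvd_imp_multiplicity_0)
    thus "\<beta> * y1 = U" using gt by (simp add: vp \<beta>_def)
    thus "\<gamma> * z1 = U" using t1(2) by simp
  qed
  have U0: "U > 0" using \<beta>U abc pos by (metis nat_0_less_mult_iff)
  have "2 ^ (n + i * w) + e ^ n = (e + 2) ^ n" using w by (simp add: i power_add power_mult)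
  with even_power_gap_two_pow2[of e n] n obtain H where n2: "n = 2" and H: "H \<ge> 1" "e + 1 = 2 ^ H"
    by auto
  obtain b0 where b0: "b = 2 ^ \<beta> * b0"
    using multiplicity_dvd[of 2 b] unfolding \<beta>_def dvd_def by blast
  obtain c0 where c0: "c = 2 ^ \<gamma> * c0"
    using multiplicity_dvd[of 2 c] unfolding \<gamma>_def dvd_def by blast
  have "2 ^ U * b0 ^ y1 = 2 ^ U * e"
    using D(2) by (simp add: b0 U power_mult_distrib power_mult[symmetric] \<beta>U)
  hence b1: "b0 ^ y1 + 1 = 2 ^ H" using H by simp
  have "2 ^ U * c0 ^ z1 = 2 ^ U * (e + 2)"
    using D(3) by (simp add: c0 U power_mult_distrib power_mult[symmetric] \<gamma>U)
  hence "c0 ^ z1 = e + 2" by (metis mult_left_cancel power_not_zero zero_neq_numeral)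
  hence c1: "c0 ^ z1 = 2 ^ H + 1" using H by simp
  have \<alpha>i: "\<alpha> = i" by (simp add: \<alpha>_def i)
  obtain T where T: "\<beta> * y3 = \<gamma> * z3 + T" "T > 0" using t3(1) less_imp_add_positive by metis
  have a3: "a ^ x3 = 2 ^ (\<gamma> * z3)" using t3(2) by (simp add: i \<alpha>i power_mult[symmetric])
  have b3: "b ^ y3 = 2 ^ (\<gamma> * z3) * (2 ^ T * b0 ^ y3)"
    by (simp add: b0 power_mult_distrib power_mult[symmetric] T(1) power_add)
  have c3: "c ^ z3 = 2 ^ (\<gamma> * z3) * c0 ^ z3" by (simp add: c0 power_mult_distrib power_mult[symmetric])
  \<comment> \<open>Type B gives the power of 2 \<open>a ^ x3\<close> the same valuation as
    \<open>c ^ z3\<close>, so dividing by it leaves the summand 1.\<close>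
  have "2 ^ (\<gamma> * z3) * (1 + 2 ^ T * b0 ^ y3) = 2 ^ (\<gamma> * z3) * c0 ^ z3"
    using e3 unfolding a3 b3 c3 by (simp add: algebra_simps)
  hence "c0 ^ z3 = 1 + 2 ^ T * b0 ^ y3" by (metis mult_left_cancel power_not_zero zero_neq_numeral)
  from pow2_family_third_solution[OF H(1) pos(2,3,5,6) T(2) U0 b1 c1 this \<beta>U \<gamma>U T(1)]
  have r: "b0 = 1" "\<gamma> = U" "H = 1" "z3 = 1 \<and> T = 1 \<or> z3 = 2 \<and> T = 3" by auto
  have e1: "e = 1" using H r(3) by simp
  have "4 * a ^ w = 8" using w by (simp add: n2 e1 power2_eq_square)
  hence aw: "a ^ w = 2" by simp
  have b1: "b ^ y1 = 2 ^ U" and a1: "a ^ x1 = 2 * 2 ^ U" using D U e1 by simp_all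
  have "b ^ y2 = (b ^ y1) ^ 2" by (simp add: n n2 power_mult[symmetric] mult.commute)
  hence b2: "b ^ y2 = 2 ^ (U * 2)" unfolding b1 by (simp only: power_mult)
  have "a ^ x2 = (a ^ x1) ^ 2 * a ^ w" by (simp add: n n2 power_add power_mult[symmetric] mult.commute)
  hence a2: "a ^ x2 = 8 * 2 ^ (U * 2)" unfolding a1 aw by (simp add: power_mult power_mult_distrib)
  \<comment> \<open>With \<open>e = 1\<close> the known solutions have summands 2*2^U, 2^U and
    8*2^(2*U), 2^(2*U). The two alternatives reproduce these in reversed order.\<close>
  from r(4) show ?thesis
  proof
    assume "z3 = 1 \<and> T = 1"
    thus ?thesis using a3 b3 a1 b1 r by (simp add: insert_commute mult.commute)
  next
    assume "z3 = 2 \<and> T = 3"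
    thus ?thesis using a3 b3 a2 b2 r by (simp add: insert_commute mult.commute)
  qed
qed

section \<open>Counting solutions and membership in the families\<close>

lemma is_solution_swap: "is_solution (b, a, c) (y, x, z) \<longleftrightarrow> is_solution (a, b, c) (x, y, z)"
  by (auto simp: add.commute)

lemma summands_swap: "summands (b, a, c) (y, x, z) = summands (a, b, c) (x, y, z)"
  by (simp add: insert_commute)

text \<open>Exhaustion is stated through \<open>summands\<close>, the equivalence used for counting,
  so the same two solutions yield both the count and the family. The notion is symmetric in
  \<open>a\<close> and \<open>b\<close>, so type A arguments also settle type B.\<close>

definition classified :: "nat \<Rightarrow> nat \<Rightarrow> nat \<Rightarrow> bool" where
  "classified a b c \<longleftrightarrow> (\<exists>s1 s2. is_solution (a, b, c) s1 \<and> is_solution (a, b, c) s2 \<and>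
     summands (a, b, c) s1 \<noteq> summands (a, b, c) s2 \<and>
     (\<forall>s. is_solution (a, b, c) s \<longrightarrow>
        summands (a, b, c) s = summands (a, b, c) s1 \<or> summands (a, b, c) s = summands (a, b, c) s2) \<and>
     (\<exists>F\<in>{family_i, family_ii, family_iii, family_iv}. in_family F ((a, b, c), s1, s2)))"

lemma classified_swap:
  assumes "classified b a c"
  shows "classified a b c"
proof -
  obtain s1 s2 F where
    s: "is_solution (b, a, c) s1" "is_solution (b, a, c) s2" "summands (b, a, c) s1 \<noteq> summands (b, a, c) s2"
    and all: "\<And>s. is_solution (b, a, c) s \<Longrightarrow>
      summands (b, a, c) s = summands (b, a, c) s1 \<or> summands (b, a, c) s = summands (b, a, c) s2"
    and F: "F \<in> {family_i, family_ii, family_iii, family_iv}" "in_family F ((b, a, c), s1, s2)"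
    using assms unfolding classified_def by blast
  obtain y1 x1 z1 where s1: "s1 = (y1, x1, z1)" by (cases s1)
  obtain y2 x2 z2 where s2: "s2 = (y2, x2, z2)" by (cases s2)
  note s = s[unfolded s1 s2] and all = all[unfolded s1 s2] and F = F[unfolded s1 s2]
  have corr: "corresponds (a, b, c) (x, y, z) T S \<longleftrightarrow> corresponds (b, a, c) (y, x, z) T S" for x y z T S
    unfolding corresponds_def is_solution_swap summands_swap ..
  have "in_family F ((a, b, c), (x1, y1, z1), (x2, y2, z2))"
    using F(2) is_solution_swap[of b a c] unfolding in_family_def by (auto simp: corr simp del: is_solution.simps)
  moreover have "summands (a, b, c) s = summands (a, b, c) (x1, y1, z1) \<or>
        summands (a, b, c) s = summands (a, b, c) (x2, y2, z2)" if "is_solution (a, b, c) s" for s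
  proof (cases s)
    case (fields x y z)
    thus ?thesis using all[of "(y, x, z)"] that
      unfolding fields is_solution_swap[of b a] summands_swap[of b a] by blast
  qed
  ultimately show ?thesis
    unfolding classified_def using s[unfolded is_solution_swap[of b a] summands_swap[of b a]] F(1)
    by (intro exI[of _ "(x1, y1, z1)"] exI[of _ "(x2, y2, z2)"] conjI allI impI bexI[of _ F])
qed

lemma solution_class:
  "is_solution t s \<Longrightarrow> same_solution_rel t `` {s} = {s'. is_solution t s' \<and> summands t s' = summands t s}"
  unfolding same_solution_rel_def by auto

lemma num_solutions_classified:
  assumes "classified a b c"
  shows "num_solutions a b c = 2"
proof -
  let ?t = "(a, b, c)"
  obtain s1 s2 where s: "is_solution ?t s1" "is_solution ?t s2" "summands ?t s1 \<noteq> summands ?t s2"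
    and all: "\<And>s. is_solution ?t s \<Longrightarrow> summands ?t s = summands ?t s1 \<or> summands ?t s = summands ?t s2"
    using assms unfolding classified_def by blast
  let ?R = "same_solution_rel ?t"
  have "{s. is_solution ?t s} // ?R = {?R `` {s1}, ?R `` {s2}}"
  proof (intro equalityI subsetI)
    fix C assume "C \<in> {s. is_solution ?t s} // ?R"
    then obtain s where C: "is_solution ?t s" "C = ?R `` {s}" by (auto simp: quotient_def simp del: is_solution.simps)
    thus "C \<in> {?R `` {s1}, ?R `` {s2}}"
      using all[of s] by (auto simp: solution_class s simp del: is_solution.simps)
  next
    fix C assume "C \<in> {?R `` {s1}, ?R `` {s2}}"
    thus "C \<in> {s. is_solution ?t s} // ?R" using s by (auto intro!: quotientI simp del: is_solution.simps)
  qed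
  moreover have "?R `` {s1} \<noteq> ?R `` {s2}" using s unfolding solution_class[OF s(1)] solution_class[OF s(2)] by blast
  ultimately show ?thesis unfolding num_solutions_def Let_def by (simp add: numeral_eq_enat)
qed

text \<open>In \<open>S_c\<close> and \<open>S_o\<close> only one solution is given explicitly; the
  second is extracted from the count.\<close>

lemma inequivalent_solution_if_num_solutions_gt_1:
  assumes "num_solutions a b c > 1" "is_solution (a, b, c) s"
  shows "\<exists>s'. is_solution (a, b, c) s' \<and> summands (a, b, c) s' \<noteq> summands (a, b, c) s"
proof (rule ccontr)
  let ?t = "(a, b, c)" and ?R = "same_solution_rel (a, b, c)"
  assume "\<not> ?thesis"
  hence all: "summands ?t s' = summands ?t s" if "is_solution ?t s'" for s' using that by blast
  have "{s. is_solution ?t s} // ?R \<subseteq> {?R `` {s}}"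
  proof
    fix C assume "C \<in> {s. is_solution ?t s} // ?R"
    then obtain s' where C: "is_solution ?t s'" "C = ?R `` {s'}" by (auto simp: quotient_def simp del: is_solution.simps)
    thus "C \<in> {?R `` {s}}" using all[of s'] assms(2) by (simp add: solution_class del: is_solution.simps)
  qed
  hence "finite ({s. is_solution ?t s} // ?R)" "card ({s. is_solution ?t s} // ?R) \<le> 1"
    by (auto intro: finite_subset dest: card_mono[rotated])
  thus False using assms(1) unfolding num_solutions_def Let_def
    by (simp add: one_enat_def del: is_solution.simps)
qed

section \<open>Membership in the families\<close>

text \<open>Only the powers have to agree, not the bases: a family entry may be
  \<open>b ^ y1\<close> itself, taken with exponent 1. The equalities also show that the family
  exponents solve the family's own equation.\<close>

lemma in_familyI:
  assumes s: "is_solution (a, b, c) (x1, y1, z1)" "is_solution (a, b, c) (x2, y2, z2)"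
    and ne: "(x1, y1, z1) \<noteq> (x2, y2, z2)"
    and F: "((A, B, C), (X1, Y1, Z1), (X2, Y2, Z2)) \<in> F"
    and pos: "X1 > 0" "Y1 > 0" "Z1 > 0" "X2 > 0" "Y2 > 0" "Z2 > 0"
    and eq: "A ^ X1 = a ^ x1" "B ^ Y1 = b ^ y1" "C ^ Z1 = c ^ z1"
      "A ^ X2 = a ^ x2" "B ^ Y2 = b ^ y2" "C ^ Z2 = c ^ z2"
  shows "in_family F ((a, b, c), (x1, y1, z1), (x2, y2, z2))"
proof -
  have "corresponds (a, b, c) (x1, y1, z1) (A, B, C) (X1, Y1, Z1)"
    "corresponds (a, b, c) (x2, y2, z2) (A, B, C) (X2, Y2, Z2)"
    using s pos eq unfolding corresponds_def by auto
  thus ?thesis unfolding in_family_def using s ne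
    by (auto intro!: bexI[OF _ F] simp del: is_solution.simps)
qed

text \<open>Take \<open>g = a\<close>, \<open>j = 1\<close>, \<open>u = x1\<close>,
  \<open>d = e\<close> and \<open>k = n\<close>; the second and third base are \<open>b ^ y1\<close>
  and \<open>c ^ z1\<close>. Consecutive \<open>n\<close>-th powers have opposite parity, so
  \<open>a\<close> is odd.\<close>

lemma gap_one_pair_in_family:
  fixes a b c :: nat
  assumes a: "a > 1"
    and s: "is_solution (a, b, c) (x1, y1, z1)" "is_solution (a, b, c) (x2, y2, z2)"
    and P: "gap_one_pair (a, b, c) (x1, y1, z1) (x2, y2, z2)"
  shows "in_family family_iii ((a, b, c), (x1, y1, z1), (x2, y2, z2))"
proof -
  obtain n e w where n: "n \<ge> 2" "e > 0" "w > 0" and s2: "x2 = n * x1 + w" "y2 = n * y1" "z2 = n * z1"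
    and 1: "b ^ y1 = a ^ x1 * e" "c ^ z1 = a ^ x1 * (e + 1)" and w: "a ^ w + e ^ n = (e + 1) ^ n"
    using P unfolding gap_one_pair_def prod.case by blast
  have pos: "x1 > 0" "y1 > 0" using s by simp_all
  have "odd (a ^ w)" using w n(1) by (metis even_add even_power odd_one not_one_le_zero zero_less_iff_neq_zero
        less_le_trans pos2)
  hence oa: "odd a" using n(3) by simp
  have mem: "((a ^ 1, a ^ (1 * x1) * e, a ^ (1 * x1) * (e + 1)), (x1, 1, 1), (n * x1 + w div 1, n, n)) \<in> family_iii"
    unfolding family_iii_def
  proof (rule CollectI, rule exI[of _ a], rule exI[of _ 1], rule exI[of _ x1], rule exI[of _ e],
      rule exI[of _ n], rule exI[of _ w], intro conjI)
    show "(e + 1) ^ n - e ^ n = a ^ w" using w by simp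
  qed (use n a oa pos in \<open>simp_all\<close>)
  have ne: "(x1, y1, z1) \<noteq> (x2, y2, z2)" using s2 n pos by auto
  show ?thesis
  proof (rule in_familyI[OF s ne mem])
    show "(a ^ (1 * x1) * e) ^ n = b ^ y2" unfolding s2 mult.commute[of n y1] power_mult 1(1) by simp
    show "(a ^ (1 * x1) * (e + 1)) ^ n = c ^ z2" unfolding s2 mult.commute[of n z1] power_mult 1(2) by simp
  qed (use n pos 1 s2 in simp_all)
qed

lemma Max_odd_divisor:
  fixes G :: nat
  assumes "odd G"
  shows "Max {n. odd n \<and> n dvd 2 ^ s * G} = G"
proof (rule Max_eqI)
  have "2 ^ s * G > 0" using assms by (simp add: odd_pos)
  hence "{n. odd n \<and> n dvd 2 ^ s * G} \<subseteq> {..2 ^ s * G}" by (auto dest: dvd_imp_le)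
  thus "finite {n. odd n \<and> n dvd 2 ^ s * G}" by (rule finite_subset) simp
  show "y \<le> G" if "y \<in> {n. odd n \<and> n dvd 2 ^ s * G}" for y
  proof -
    have "coprime y (2 ^ s)" using that by simp
    hence "y dvd G" using that by (simp add: coprime_dvd_mult_right_iff)
    thus ?thesis using assms by (intro dvd_imp_le) (auto simp: odd_pos)
  qed
qed (use assms in simp)

text \<open>Write \<open>a = 2 ^ i * g\<close> with \<open>g\<close> odd. If \<open>g = 1\<close>,
  the reduced equation is purely one of powers of 2 and gives family (i); if \<open>g > 1\<close>,
  the data fit family (iv) with \<open>j = 1\<close>.\<close>

lemma gap_two_pair_in_family:
  fixes a b c :: nat
  assumes a: "a > 1" and p: "prime p" "p dvd b" "p dvd c"
    and s: "is_solution (a, b, c) (x1, y1, z1)" "is_solution (a, b, c) (x2, y2, z2)"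
    and P: "gap_two_pair (a, b, c) (x1, y1, z1) (x2, y2, z2)"
  shows "in_family family_i ((a, b, c), (x1, y1, z1), (x2, y2, z2)) \<or>
    in_family family_iv ((a, b, c), (x1, y1, z1), (x2, y2, z2))"
proof -
  obtain n e w D where n: "n \<ge> 2" "even n" "odd e" "w > 0" and s2: "x2 = n * x1 + w" "y2 = n * y1" "z2 = n * z1"
    and D: "a ^ x1 = 2 * D" "b ^ y1 = D * e" "c ^ z1 = D * (e + 2)" and w: "2 ^ n * a ^ w + e ^ n = (e + 2) ^ n"
    using P unfolding gap_two_pair_def prod.case by blast
  have pos: "x1 > 0" "y1 > 0" "z1 > 0" using s by simp_all
  have ne: "(x1, y1, z1) \<noteq> (x2, y2, z2)" using s2 n pos by auto
  have D0: "D > 0" using D(1) a by (cases D) auto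
  have by2: "b ^ y2 = (D * e) ^ n" "c ^ z2 = (D * (e + 2)) ^ n" "a ^ x2 = (2 * D) ^ n * a ^ w"
    unfolding s2 mult.commute[of n] power_add power_mult D by simp_all
  \<comment> \<open>This yields \<open>u > 0\<close> in family (i). If \<open>p\<close> did not
    divide \<open>D\<close>, it would divide both \<open>e\<close> and \<open>e + 2\<close>, hence
    be 2, while \<open>e\<close> is odd.\<close>
  have pD: "p dvd D"
  proof (rule ccontr)
    assume nD: "\<not> p dvd D"
    have "p dvd D * e" "p dvd D * (e + 2)"
      unfolding D(2,3)[symmetric] using p pos by (simp_all add: prime_dvd_power_iff)
    hence pe: "p dvd e" "p dvd e + 2" using nD p(1) by (meson prime_dvd_multD)+
    hence "p dvd 2" by (metis dvd_add_right_iff)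
    hence "p = 2" using p(1) by (metis primes_dvd_imp_eq two_is_prime_nat)
    thus False using pe n(3) by simp
  qed
  define i where "i = multiplicity 2 a"
  obtain g where g: "a = 2 ^ i * g" "odd g"
    using multiplicity_decompose'[of a 2] a unfolding i_def by auto
  have ev: "even (a ^ x1)" using D(1) by simp
  hence i0: "i > 0" using g by (cases i) simp_all
  have ix: "i * x1 \<ge> 1" using i0 pos by (simp add: Suc_le_eq)
  have "2 * 2 ^ (i * x1 - 1) = (2::nat) ^ (i * x1)" using ix by (metis Suc_pred' less_eq_Suc_le One_nat_def power_Suc)
  hence "2 * (2 ^ (i * x1 - 1) * g ^ x1) = a ^ x1" by (simp add: g(1) power_mult_distrib power_mult)
  hence Dg: "2 ^ (i * x1 - 1) * g ^ x1 = D" using D(1) by simp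
  have diff: "(e + 2) ^ n - e ^ n = 2 ^ (n + i * w) * g ^ w"
  proof -
    have "2 ^ n * a ^ w = 2 ^ (n + i * w) * g ^ w"
      by (simp add: g(1) power_mult_distrib power_mult power_add)
    thus ?thesis using w by simp
  qed
  show ?thesis
  proof (cases "g = 1")
    case True
    have "2 ^ (n + i * w) + e ^ n = (e + 2) ^ n"
      using w by (simp add: g(1) True power_add power_mult)
    from even_power_gap_two_pow2[OF n(3,2) _ this] n obtain H where n2: "n = 2" and H: "H \<ge> 1" "e + 1 = 2 ^ H"
      by auto
    define U where "U = i * x1 - 1"
    have DU: "D = 2 ^ U" using Dg True by (simp add: U_def)
    have U0: "U > 0"
    proof (rule ccontr)
      assume "\<not> U > 0"
      hence "D = 1" using DU by simp
      thus False using pD p(1) by (simp add: prime_nat_iff)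
    qed
    have e: "e = 2 ^ H - 1" "e + 2 = 2 ^ H + 1" using H by simp_all
    have "4 * a ^ w + e ^ 2 = (e + 2) ^ 2" using w n2 by simp
    hence "4 * a ^ w = 4 * (e + 1)" by (simp add: power2_eq_square algebra_simps)
    hence aw: "a ^ w = 2 ^ H" using H by simp
    \<comment> \<open>The parameter \<open>h\<close> is \<open>H + 1\<close>, since
      \<open>e = 2 ^ H - 1\<close>.\<close>
    have "((2, 2 ^ U * (2 ^ (H + 1 - 1) - 1), 2 ^ U * (2 ^ (H + 1 - 1) + 1)),
      (U + 1, 1, 1), (2 * U + (H + 1) + 1, 2, 2)) \<in> family_i"
      unfolding family_i_def using U0 H(1) by (intro CollectI exI[of _ U] exI[of _ "H + 1"]) simp
    hence "in_family family_i ((a, b, c), (x1, y1, z1), (x2, y2, z2))"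
    proof (rule in_familyI[OF s ne])
      show "(2 ^ U * (2 ^ (H + 1 - 1) - 1)) ^ 1 = b ^ y1" using D(2) by (simp add: DU e(1))
      show "(2 ^ U * (2 ^ (H + 1 - 1) + 1)) ^ 1 = c ^ z1" using D(3) unfolding e(2) by (simp add: DU)
      show "(2 ^ U * (2 ^ (H + 1 - 1) - 1)) ^ 2 = b ^ y2" using by2(1) by (simp add: DU e(1) n2)
      show "(2 ^ U * (2 ^ (H + 1 - 1) + 1)) ^ 2 = c ^ z2" using by2(2) unfolding e(2) by (simp add: DU n2)
      show "2 ^ (U + 1) = a ^ x1" using D(1) by (simp add: DU)
      have "2 * U + (H + 1) + 1 = (U + 1) * 2 + H" by simp
      hence "(2::nat) ^ (2 * U + (H + 1) + 1) = (2 * 2 ^ U) ^ 2 * 2 ^ H"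
        by (simp only: power_add power_mult power_one_right mult.commute)
      thus "2 ^ (2 * U + (H + 1) + 1) = a ^ x2" using by2(3) by (simp only: DU n2 aw)
    qed simp_all
    thus ?thesis ..
  next
    case False
    hence g1: "g > 1" using g(2) by (cases g) auto
    have og: "odd (g ^ w)" using g(2) by simp
    have "multiplicity 2 (2 ^ (n + i * w) * g ^ w) = n + i * w"
      by (rule multiplicity_decomposeI[OF refl]) (use og in simp_all)
    moreover have "multiplicity 2 ((e + 2) ^ n - e ^ n) = multiplicity 2 (2 * e + 2) + multiplicity 2 n"
      by (rule multiplicity_even_power_gap_two) (use n in simp_all)
    \<comment> \<open>The valuation of \<open>(e + 2) ^ n - e ^ n\<close> at 2, computed in two
      ways, is the condition on \<open>k - v\<close> in family (iv).\<close>
    ultimately have v: "n + i * w = multiplicity 2 (2 * e + 2) + multiplicity 2 n" by (simp only: diff)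
    have "((2 ^ i * g ^ 1, 2 ^ (i * x1 - 1) * g ^ (1 * x1) * e, 2 ^ (i * x1 - 1) * g ^ (1 * x1) * (e + 2)),
      (x1, 1, 1), (n * x1 + w div 1, n, n)) \<in> family_iv"
      unfolding family_iv_def
    proof (rule CollectI, rule exI[of _ i], rule exI[of _ g], rule exI[of _ 1], rule exI[of _ x1],
        rule exI[of _ e], rule exI[of _ n], rule exI[of _ w], intro conjI)
      show "g ^ w = Max {m. odd m \<and> m dvd (e + 2) ^ n - e ^ n}" unfolding diff Max_odd_divisor[OF og] ..
      have "real (n + i * w) = real (multiplicity 2 (2 * e + 2) + multiplicity 2 n)" by (simp only: v)
      thus "real n - real (multiplicity 2 n) = real (multiplicity 2 (2 * e + 2)) - real i * real w / real 1" by simp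
    qed (use n i0 g g1 pos in \<open>simp_all add: odd_pos\<close>)
    hence "in_family family_iv ((a, b, c), (x1, y1, z1), (x2, y2, z2))"
    proof (rule in_familyI[OF s ne])
      show "(2 ^ i * g ^ 1) ^ (n * x1 + w div 1) = a ^ x2" by (simp add: g(1) s2)
      show "(2 ^ (i * x1 - 1) * g ^ (1 * x1) * e) ^ n = b ^ y2" by (simp only: by2 mult_1 Dg)
      show "(2 ^ (i * x1 - 1) * g ^ (1 * x1) * (e + 2)) ^ n = c ^ z2" by (simp only: by2 mult_1 Dg)
      show "(2 ^ (i * x1 - 1) * g ^ (1 * x1) * e) ^ 1 = b ^ y1" by (simp only: D mult_1 Dg power_one_right)
      show "(2 ^ (i * x1 - 1) * g ^ (1 * x1) * (e + 2)) ^ 1 = c ^ z1" by (simp only: D mult_1 Dg power_one_right)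
    qed (use n pos g in simp_all)
    thus ?thesis ..
  qed
qed

section \<open>The classification\<close>

text \<open>A third solution is treated by its type at \<open>p\<close>. Type A or O would form gap
  pairs with both known solutions; type C conflicts with the second one; for type B the argument
  depends on whether the first one is of type O or A.\<close>

lemma classified_if_gap_pair:
  fixes a b c :: nat
  assumes gt: "a > 1" "b > 1" "c > 1" and p: "prime p" "p dvd a" "p dvd b" "p dvd c"
    and s: "is_solution (a, b, c) (x1, y1, z1)" "is_solution (a, b, c) (x2, y2, z2)"
    and t1: "type_A p (a, b, c) (x1, y1, z1) \<or> type_O p (a, b, c) (x1, y1, z1)"
    and t2: "type_A p (a, b, c) (x2, y2, z2) \<or> type_O p (a, b, c) (x2, y2, z2)"
    and P: "gap_pair (a, b, c) (x1, y1, z1) (x2, y2, z2)"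
  shows "classified a b c"
proof -
  obtain n where n: "n \<ge> 2" "n * x1 < x2" "y2 = n * y1" "z2 = n * z1"
    using gap_pair_exponents[OF P] by blast
  have va: "multiplicity p a > 0" using p gt by (simp add: prime_multiplicity_gt_zero_iff)
  \<comment> \<open>Passing to the second solution multiplies the valuation of \<open>b ^ y1\<close>
    by exactly \<open>n\<close>, but that of \<open>a ^ x1\<close> by more, since
    \<open>n * x1 < x2\<close>.\<close>
  have "\<not> type_O p (a, b, c) (x2, y2, z2)"
  proof
    assume O: "type_O p (a, b, c) (x2, y2, z2)"
    have "n * (multiplicity p b * y1) \<le> n * (multiplicity p a * x1)" using t1 by (intro mult_le_mono2) auto
    also have "\<dots> = multiplicity p a * (n * x1)" by (simp add: algebra_simps)
    also have "\<dots> < multiplicity p a * x2" using va n(2) by simp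
    finally show False using O n(3) by (simp add: algebra_simps)
  qed
  hence A2: "type_A p (a, b, c) (x2, y2, z2)" using t2 by blast
  have fam: "\<exists>F\<in>{family_i, family_ii, family_iii, family_iv}. in_family F ((a, b, c), (x1, y1, z1), (x2, y2, z2))"
    using P gap_one_pair_in_family[OF gt(1) s] gap_two_pair_in_family[OF gt(1) p(1,3,4) s]
    unfolding gap_pair_def by blast
  have ne: "summands (a, b, c) (x1, y1, z1) \<noteq> summands (a, b, c) (x2, y2, z2)"
  proof
    assume "summands (a, b, c) (x1, y1, z1) = summands (a, b, c) (x2, y2, z2)"
    hence "a ^ x1 + b ^ y1 = a ^ x2 + b ^ y2" by (auto simp: doubleton_eq_iff)
    hence "c ^ z1 = c ^ z2" using s by simp
    hence "z1 = n * z1" using gt(3) n(4) by simp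
    thus False using s n(1) by simp
  qed
  have third: "summands (a, b, c) (x3, y3, z3) = summands (a, b, c) (x1, y1, z1) \<or>
      summands (a, b, c) (x3, y3, z3) = summands (a, b, c) (x2, y2, z2)"
    if s3: "is_solution (a, b, c) (x3, y3, z3)" for x3 y3 z3
  proof (cases "(x3, y3, z3) = (x1, y1, z1) \<or> (x3, y3, z3) = (x2, y2, z2)")
    case False
    have pos: "x1 > 0" "y1 > 0" "z1 > 0" "x3 > 0" "y3 > 0" "z3 > 0" using s(1) s3 by simp_all
    have e: "a ^ x3 + b ^ y3 = c ^ z3" "a ^ x2 + b ^ y2 = c ^ z2" using s3 s(2) by simp_all
    have AO: False if t3: "type_A p (a, b, c) (x3, y3, z3) \<or> type_O p (a, b, c) (x3, y3, z3)"
    proof -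
      have "gap_pair (a, b, c) (x1, y1, z1) (x3, y3, z3) \<or> gap_pair (a, b, c) (x3, y3, z3) (x1, y1, z1)"
        by (rule gap_pair_if_proportional[OF gt p(1,3,4) s(1) s3]) (use t1 t3 False in auto)
      moreover have "gap_pair (a, b, c) (x2, y2, z2) (x3, y3, z3) \<or> gap_pair (a, b, c) (x3, y3, z3) (x2, y2, z2)"
        by (rule gap_pair_if_proportional[OF gt p(1,3,4) s(2) s3]) (use t2 t3 False in auto)
      ultimately show False using gap_pair_gcd[OF _ gt(1)] P by blast
    qed
    from solution_type_cases[OF p(1), of a b c x3 y3 z3] gt e(1) AO
    consider (B) "type_B p (a, b, c) (x3, y3, z3)" | (C) "type_C p (a, b, c) (x3, y3, z3)"
      by (metis less_trans zero_less_one)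
    thus ?thesis
    proof cases
      case C
      thus ?thesis using no_type_C_and_type_A[OF p(1,2) gt e(1) C pos(4-6) e(2) A2] by blast
    next
      case B
      show ?thesis
      proof (cases "type_O p (a, b, c) (x1, y1, z1)")
        case True
        have "gap_pair (b, a, c) (y1, x1, z1) (y3, x3, z3) \<or> gap_pair (b, a, c) (y3, x3, z3) (y1, x1, z1)"
          by (rule gap_pair_if_proportional[OF gt(2,1,3) p(1,2,4)]) (use s s3 B True False in auto)
        \<comment> \<open>The later member of a gap pair for \<open>(b, a, c)\<close> is strictly of
          type B, so the type O solution has to be the earlier one.\<close>
        moreover have "\<not> gap_pair (b, a, c) (y3, x3, z3) (y1, x1, z1)"
        proof
          assume "gap_pair (b, a, c) (y3, x3, z3) (y1, x1, z1)"
          then obtain m where m: "m \<ge> 2" "m * y3 < y1" "x1 = m * x3" using gap_pair_exponents by blast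
          have "multiplicity p b * (m * y3) \<le> multiplicity p b * y1" using m by simp
          also have "\<dots> = m * (multiplicity p a * x3)" using True m(3) by (simp add: algebra_simps)
          also have "\<dots> < m * (multiplicity p b * y3)" using B m(1) by simp
          finally show False by (simp add: algebra_simps)
        qed
        ultimately have "gap_pair (b, a, c) (y1, x1, z1) (y3, x3, z3)" by blast
        from third_solution_type_O_B[OF gt(1,2) pos(1,2) P this] show ?thesis by simp
      next
        case False
        hence "type_A p (a, b, c) (x1, y1, z1)" using t1 by blast
        from third_solution_type_A_B[OF gt p s(1) this s3 B P] show ?thesis by simp
      qed
    qed
  qed auto
  show ?thesis unfolding classified_def
  proof (rule exI[of _ "(x1, y1, z1)"], rule exI[of _ "(x2, y2, z2)"], intro conjI allI impI s ne fam)
    fix s3 assume "is_solution (a, b, c) s3"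
    thus "summands (a, b, c) s3 = summands (a, b, c) (x1, y1, z1) \<or> summands (a, b, c) s3 = summands (a, b, c) (x2, y2, z2)"
      by (cases s3) (use third in blast)
  qed
qed

lemma classified_if_type_A_O:
  fixes a b c :: nat
  assumes gt: "a > 1" "b > 1" "c > 1" and p: "prime p" "p dvd a" "p dvd b" "p dvd c"
    and s: "is_solution (a, b, c) s1" "is_solution (a, b, c) s2" "s1 \<noteq> s2"
    and t1: "type_A p (a, b, c) s1 \<or> type_O p (a, b, c) s1"
    and t2: "type_A p (a, b, c) s2 \<or> type_O p (a, b, c) s2"
  shows "classified a b c"
proof -
  obtain x1 y1 z1 where s1: "s1 = (x1, y1, z1)" by (cases s1)
  obtain x2 y2 z2 where s2: "s2 = (x2, y2, z2)" by (cases s2)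
  note s = s[unfolded s1 s2] and t1 = t1[unfolded s1] and t2 = t2[unfolded s2]
  have "gap_pair (a, b, c) (x1, y1, z1) (x2, y2, z2) \<or> gap_pair (a, b, c) (x2, y2, z2) (x1, y1, z1)"
    by (rule gap_pair_if_proportional[OF gt p(1,3,4) s(1,2)]) (use t1 t2 s(3) in auto)
  thus ?thesis
    using classified_if_gap_pair[OF gt p s(1,2) t1 t2] classified_if_gap_pair[OF gt p s(2,1) t2 t1] by blast
qed

lemma type_swap:
  "type_A p (b, a, c) (y, x, z) = type_B p (a, b, c) (x, y, z)"
  "type_B p (b, a, c) (y, x, z) = type_A p (a, b, c) (x, y, z)"
  "type_C p (b, a, c) (y, x, z) = type_C p (a, b, c) (x, y, z)"
  "type_O p (b, a, c) (y, x, z) = type_O p (a, b, c) (x, y, z)"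
  by auto

lemma classified_if_type_B_O:
  fixes a b c :: nat
  assumes gt: "a > 1" "b > 1" "c > 1" and p: "prime p" "p dvd a" "p dvd b" "p dvd c"
    and s: "is_solution (a, b, c) s1" "is_solution (a, b, c) s2" "s1 \<noteq> s2"
    and t1: "type_B p (a, b, c) s1 \<or> type_O p (a, b, c) s1"
    and t2: "type_B p (a, b, c) s2 \<or> type_O p (a, b, c) s2"
  shows "classified a b c"
proof (rule classified_swap)
  obtain x1 y1 z1 where s1: "s1 = (x1, y1, z1)" by (cases s1)
  obtain x2 y2 z2 where s2: "s2 = (x2, y2, z2)" by (cases s2)
  show "classified b a c"
  proof (rule classified_if_type_A_O[OF gt(2,1,3) p(1,3,2,4)])
    show "is_solution (b, a, c) (y1, x1, z1)" "is_solution (b, a, c) (y2, x2, z2)"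
      using s unfolding s1 s2 is_solution_swap[of b a] by blast+
    show "(y1, x1, z1) \<noteq> (y2, x2, z2)" using s(3) unfolding s1 s2 by auto
    show "type_A p (b, a, c) (y1, x1, z1) \<or> type_O p (b, a, c) (y1, x1, z1)"
      "type_A p (b, a, c) (y2, x2, z2) \<or> type_O p (b, a, c) (y2, x2, z2)"
      using t1 t2 unfolding s1 s2 type_swap[where b = b and a = a] by blast+
  qed
qed

section \<open>Type C solutions and family (ii)\<close>

text \<open>The pair comes from 2*D + D = 3*D and 8*D^3 + D^3 = 9*D^3. The disjunction records which
  of \<open>a\<close> and \<open>b\<close> carries the factor 2.\<close>

definition tripled_pair :: "triple \<Rightarrow> triple \<Rightarrow> triple \<Rightarrow> bool" where
  "tripled_pair = (\<lambda>(a, b, c) (x1, y1, z1) (x2, y2, z2). x2 = 3 * x1 \<and> y2 = 3 * y1 \<and>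
    (\<exists>D. a ^ x1 = 2 * D \<and> b ^ y1 = D \<or> a ^ x1 = D \<and> b ^ y1 = 2 * D) \<and>
    (\<forall>r. prime r \<longrightarrow> r dvd c \<longrightarrow> r = 3))"

text \<open>Unequal \<open>e\<close> and \<open>f\<close> reduce to the coprime classification. If
  they are equal, the equations are \<open>2 * A ^ m = c ^ z1\<close> and
  \<open>2 * A ^ n = c ^ z2\<close>; at an odd prime of \<open>c\<close> they would force
  \<open>z2 * m = z1 * n\<close>, against the size comparison, so everything is a power of
  2.\<close>

lemma tripled_pair_of_power_sums:
  fixes a b c :: nat
  assumes gt: "a > 1" "b > 1" "c > 1" and mn: "0 < m" "m < n" "coprime m n" and hk: "h > 0" "k > 0"
    and 1: "a ^ (m * h) + b ^ (m * k) = c ^ z1" and 2: "a ^ (n * h) + b ^ (n * k) = c ^ z2"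
  shows "(\<exists>i j l. a = 2 ^ i \<and> b = 2 ^ j \<and> c = 2 ^ l) \<or>
    tripled_pair (a, b, c) (m * h, m * k, z1) (n * h, n * k, z2)"
proof -
  define A B where "A = a ^ h" and "B = b ^ k"
  have AB0: "A > 0" "B > 0" using gt by (simp_all add: A_def B_def)
  have r1: "A ^ m + B ^ m = c ^ z1" and r2: "A ^ n + B ^ n = c ^ z2"
    using 1 2 by (simp_all add: A_def B_def power_mult[symmetric] mult.commute)
  obtain D e f where D: "D > 0" "A = D * e" "B = D * f" "coprime e f"
    using coprime_decomposition[OF AB0(1)] by blast
  have ef0: "e > 0" "f > 0" using D AB0 by (cases e; cases f; simp)+
  consider (eq) "e = f" | (lt) "e < f" | (gt) "f < e" by linarith
  thus ?thesis
  proof cases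
    case eq
    hence "e = 1" using D(4) by simp
    hence AB: "A = B" using D eq by simp
    have zz: "z2 * m < z1 * n"
    proof -
      have "(c ^ z2) ^ m < (c ^ z1) ^ n"
        using power_sum_power_less[OF AB0 mn(1,2)] unfolding r1 r2 .
      hence "c ^ (z2 * m) < c ^ (z1 * n)" by (simp only: power_mult)
      thus ?thesis by (rule power_less_imp_less_exp[OF gt(3)])
    qed
    have "r = 2" if r: "prime r" "r dvd c" for r
    proof (rule ccontr)
      assume "r \<noteq> 2"
      hence "\<not> r dvd 2" using r(1) by (metis primes_dvd_imp_eq two_is_prime_nat)
      hence v: "multiplicity r (2 * A ^ l) = l * multiplicity r A" for l
        using r(1) AB0 by (simp add: prime_elem_multiplicity_mult_distrib
            prime_elem_multiplicity_power_distrib not_dvd_imp_multiplicity_0)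
      have "2 * A ^ m = c ^ z1" "2 * A ^ n = c ^ z2" using r1 r2 AB by simp_all
      hence "multiplicity r c * z1 = m * multiplicity r A" "multiplicity r c * z2 = n * multiplicity r A"
        using v[of m] v[of n] r(1) gt by (simp_all add: multiplicity_prime_power_nat)
      hence "multiplicity r c * (z2 * m) = multiplicity r c * (z1 * n)"
        by (metis mult.assoc mult.commute)
      moreover have "multiplicity r c > 0" using r gt by (simp add: prime_multiplicity_gt_zero_iff)
      ultimately show False using zz by simp
    qed
    then obtain l where l: "c = 2 ^ l"
      using power_of_prime_if_unique_prime_factor[of c 2] gt by auto
    have "2 * A ^ m = c ^ z1" using r1 AB by simp
    hence "A ^ m dvd 2 ^ (l * z1)" by (metis dvd_triv_right l power_mult)
    then obtain j where j: "A ^ m = 2 ^ j" using divides_primepow_nat[of 2 "A ^ m"] by auto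
    have "a ^ (h * m) = 2 ^ j" "b ^ (k * m) = 2 ^ j" using j AB by (simp_all add: A_def B_def power_mult)
    hence "\<exists>i. a = 2 ^ i" "\<exists>i. b = 2 ^ i"
      using base_power_of_prime[OF two_is_prime_nat] hk mn by (metis nat_0_less_mult_iff)+
    thus ?thesis using l by blast
  next
    case lt
    have s: "(D * f) ^ m + (D * e) ^ m = c ^ z1" "(D * f) ^ n + (D * e) ^ n = c ^ z2"
      using r1 r2 unfolding D(2,3) by (simp_all add: add.commute)
    have "m = 1 \<and> n = 3 \<and> f = 2 \<and> e = 1 \<and> (\<forall>r. prime r \<longrightarrow> r dvd c \<longrightarrow> r = 3)"
      by (rule power_sum_pair_coprime[OF gt(3) D(1) ef0(1) lt D(4) mn s])
    hence "tripled_pair (a, b, c) (m * h, m * k, z1) (n * h, n * k, z2)"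
      using D(2,3) unfolding tripled_pair_def A_def B_def by auto
    thus ?thesis ..
  next
    case gt': gt
    have ce: "coprime f e" using D(4) by (simp add: coprime_commute)
    have s: "(D * e) ^ m + (D * f) ^ m = c ^ z1" "(D * e) ^ n + (D * f) ^ n = c ^ z2"
      using r1 r2 unfolding D(2,3) by simp_all
    have "m = 1 \<and> n = 3 \<and> e = 2 \<and> f = 1 \<and> (\<forall>r. prime r \<longrightarrow> r dvd c \<longrightarrow> r = 3)"
      by (rule power_sum_pair_coprime[OF gt(3) D(1) ef0(2) gt' ce mn s])
    hence "tripled_pair (a, b, c) (m * h, m * k, z1) (n * h, n * k, z2)"
      using D(2,3) unfolding tripled_pair_def A_def B_def by auto
    thus ?thesis ..
  qed
qed

lemma tripled_pair_if_proportional: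
  fixes a b c :: nat
  assumes gt: "a > 1" "b > 1" "c > 1" and p: "prime p" "p dvd a" "p dvd b"
    and 1: "is_solution (a, b, c) (x1, y1, z1)" and 2: "is_solution (a, b, c) (x2, y2, z2)"
    and t: "multiplicity p a * x1 = multiplicity p b * y1" "multiplicity p a * x2 = multiplicity p b * y2"
    and ne: "(x1, y1, z1) \<noteq> (x2, y2, z2)"
  shows "(\<exists>i j l. a = 2 ^ i \<and> b = 2 ^ j \<and> c = 2 ^ l) \<or>
    tripled_pair (a, b, c) (x1, y1, z1) (x2, y2, z2) \<or> tripled_pair (a, b, c) (x2, y2, z2) (x1, y1, z1)"
proof -
  have v: "multiplicity p a > 0" "multiplicity p b > 0" using p gt by (simp_all add: prime_multiplicity_gt_zero_iff)
  have "(multiplicity p a * multiplicity p b) * (x1 * y2) = (multiplicity p a * x1) * (multiplicity p b * y2)"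
    by (simp add: algebra_simps)
  also have "\<dots> = (multiplicity p b * y1) * (multiplicity p a * x2)" by (simp only: t)
  also have "\<dots> = (multiplicity p a * multiplicity p b) * (x2 * y1)" by (simp add: algebra_simps)
  finally have "x1 * y2 = x2 * y1" using v by simp
  with 1 2 proportional_pairs[of x1 y2 x2 y1] obtain m n h k where mn: "coprime m n" "m > 0" "n > 0" "h > 0"
    "x1 = m * h" "x2 = n * h" "y1 = m * k" "y2 = n * k" by auto
  have k: "k > 0" using 1 mn by simp
  have "m \<noteq> n"
  proof
    assume mn': "m = n"
    have "c ^ z1 = c ^ z2" using 1 2 mn mn' by simp
    hence "z1 = z2" using gt by simp
    thus False using ne mn mn' by simp
  qed
  thus ?thesis
    using tripled_pair_of_power_sums[OF gt, of m n h k z1 z2] tripled_pair_of_power_sums[OF gt, of n m h k z2 z1]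
      mn k 1 2 by (cases "m < n") (auto simp: coprime_commute)
qed

text \<open>\<open>c\<close>, \<open>D\<close> and \<open>b\<close> are powers of 3, and the single
  factor 2 in \<open>a ^ x1\<close> forces \<open>x1 = 1\<close>. At the prime 3, type A would give
  \<open>b ^ y3 = c ^ z3\<close> and type B \<open>c ^ z3 \<le> a ^ x3\<close>, so any other
  solution is proportional to the first and forms a tripled pair with it; \<open>x1 = 1\<close>
  excludes that it is the smaller one.\<close>

lemma classified_if_tripled_pair:
  fixes a b c :: nat
  assumes gt: "a > 1" "b > 1" "c > 1"
    and s: "is_solution (a, b, c) (x1, y1, z1)" "is_solution (a, b, c) (x2, y2, z2)"
    and P: "x2 = 3 * x1" "y2 = 3 * y1" "a ^ x1 = 2 * D" "b ^ y1 = D" "\<And>r. prime r \<Longrightarrow> r dvd c \<Longrightarrow> r = 3"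
  shows "classified a b c"
proof -
  have pos: "x1 > 0" "y1 > 0" "z1 > 0" "x2 > 0" "y2 > 0" "z2 > 0" using s by simp_all
  have p3: "prime (3::nat)" by simp
  have "c > 0" using gt(3) by simp
  from power_of_prime_if_unique_prime_factor[OF this p3 P(5)] obtain \<gamma> where \<gamma>: "c = 3 ^ \<gamma>" by blast
  have c1: "c ^ z1 = 3 * D" using s(1) P(3,4) by simp
  hence "D dvd 3 ^ (\<gamma> * z1)" by (metis \<gamma> dvd_triv_right power_mult)
  then obtain t where t: "D = 3 ^ t" using divides_primepow_nat[OF p3] by blast
  obtain \<beta> where \<beta>: "b = 3 ^ \<beta>" using base_power_of_prime[OF p3, of b y1 t] P(4) t pos by auto
  have t0: "t > 0"
  proof (rule ccontr)
    assume "\<not> t > 0"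
    hence "b ^ y1 = 1" using P(4) t by simp
    thus False using gt(2) pos by simp
  qed
  have x1: "x1 = 1"
  proof -
    have "multiplicity 2 (2 ^ 1 * (3::nat) ^ t) = 1"
      by (rule multiplicity_decomposeI[OF refl]) simp_all
    hence "multiplicity 2 a * x1 = 1"
      using P(3) t gt(1) by (simp add: multiplicity_prime_power_nat[symmetric])
    thus ?thesis by simp
  qed
  have a: "a = 2 * 3 ^ t" using P(3) t x1 by simp
  have ne: "(x1, y1, z1) \<noteq> (x2, y2, z2)" using P(1) pos by simp
  have by2: "b ^ y2 = (3 ^ t) ^ 3"
    unfolding P(2) mult.commute[of 3 y1] power_mult P(4) t ..
  have mem: "((2 * 3 ^ t, 3, 3), (1, t, t + 1), (3, 3 * t, 3 * t + 2)) \<in> family_ii"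
    unfolding family_ii_def using t0 by blast
  have "in_family family_ii ((a, b, c), (x1, y1, z1), (x2, y2, z2))"
  proof (rule in_familyI[OF s ne mem])
    show "3 ^ (3 * t) = b ^ y2" by (simp add: by2 power_mult[symmetric] mult.commute)
    have "c ^ z2 = a ^ x2 + b ^ y2" using s(2) by simp
    also have "\<dots> = 9 * (3 ^ t) ^ 3" by (simp add: by2 P(1) x1 a power_mult_distrib)
    also have "\<dots> = 3 ^ (3 * t + 2)" by (simp add: power_add power_mult[symmetric] mult.commute)
    finally show "3 ^ (3 * t + 2) = c ^ z2" ..
  qed (use t0 P(1) c1 t x1 a P(4) in simp_all)
  moreover have "summands (a, b, c) (x1, y1, z1) \<noteq> summands (a, b, c) (x2, y2, z2)"
  proof
    assume "summands (a, b, c) (x1, y1, z1) = summands (a, b, c) (x2, y2, z2)"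
    hence "a ^ x1 + b ^ y1 = a ^ x2 + b ^ y2" by (auto simp: doubleton_eq_iff)
    moreover have "a ^ x1 < a ^ x2" "b ^ y1 < b ^ y2" using gt P(1,2) pos by simp_all
    ultimately show False by linarith
  qed
  moreover have "(x3, y3) = (x1, y1) \<or> (x3, y3) = (x2, y2)"
    if s3: "is_solution (a, b, c) (x3, y3, z3)" for x3 y3 z3
  proof (cases "(x3, y3, z3) = (x1, y1, z1)")
    case False
    have e3: "a ^ x3 + b ^ y3 = c ^ z3" and x3: "x3 > 0" using s3 by simp_all
    have va: "multiplicity 3 a = t" unfolding a
      by (rule multiplicity_decomposeI[of _ 3 t 2]) simp_all
    have vb: "multiplicity 3 b = \<beta>" "multiplicity 3 c = \<gamma>" by (simp_all add: \<beta> \<gamma>)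
    have a3: "a ^ x3 > 0" using gt by simp
    have "\<not> type_A 3 (a, b, c) (x3, y3, z3)"
    proof
      assume "type_A 3 (a, b, c) (x3, y3, z3)"
      hence "b ^ y3 = c ^ z3" by (simp add: vb) (simp add: \<beta> \<gamma> power_mult[symmetric])
      thus False using e3 a3 by simp
    qed
    moreover have "\<not> type_B 3 (a, b, c) (x3, y3, z3)"
    proof
      assume "type_B 3 (a, b, c) (x3, y3, z3)"
      hence "t * x3 = \<gamma> * z3" by (simp add: va vb)
      hence "c ^ z3 = (3 ^ t) ^ x3" by (simp add: \<gamma> power_mult[symmetric])
      also have "\<dots> \<le> a ^ x3" unfolding a by (intro power_mono) simp_all
      finally have "b ^ y3 = 0" using e3 by linarith
      thus False using gt by simp
    qed
    ultimately have "multiplicity 3 a * x3 = multiplicity 3 b * y3"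
      using solution_type_cases[OF p3, of a b c x3 y3 z3] gt e3 by auto
    moreover have "multiplicity 3 a * x1 = multiplicity 3 b * y1"
    proof -
      have "3 ^ (\<beta> * y1) = (3::nat) ^ t" using P(4) t by (simp add: \<beta> power_mult)
      hence "\<beta> * y1 = t" by simp
      thus ?thesis by (simp add: va vb x1)
    qed
    moreover have "3 dvd a" "3 dvd b" using t0 a \<beta> gt by (cases \<beta>; simp)+
    ultimately have "(\<exists>i j l. a = 2 ^ i \<and> b = 2 ^ j \<and> c = 2 ^ l) \<or>
      tripled_pair (a, b, c) (x1, y1, z1) (x3, y3, z3) \<or> tripled_pair (a, b, c) (x3, y3, z3) (x1, y1, z1)"
      using False by (intro tripled_pair_if_proportional[OF gt p3 _ _ s(1) s3]) auto
    moreover have "\<not> (\<exists>i j l. a = 2 ^ i \<and> b = 2 ^ j \<and> c = 2 ^ l)"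
    proof
      assume "\<exists>i j l. a = 2 ^ i \<and> b = 2 ^ j \<and> c = 2 ^ l"
      then obtain i where "a = 2 ^ i" by blast
      hence "(3::nat) dvd 2 ^ i" using \<open>3 dvd a\<close> by simp
      hence "(3::nat) dvd 2" using p3 prime_dvd_power by blast
      thus False by simp
    qed
    ultimately have "x3 = 3 * x1 \<and> y3 = 3 * y1 \<or> x1 = 3 * x3"
      unfolding tripled_pair_def by auto
    thus ?thesis using P(1,2) x1 by auto
  qed simp
  hence "summands (a, b, c) s3 = summands (a, b, c) (x1, y1, z1) \<or>
      summands (a, b, c) s3 = summands (a, b, c) (x2, y2, z2)" if "is_solution (a, b, c) s3" for s3
    using that by (cases s3) (metis Pair_inject summands.simps)
  ultimately show ?thesis unfolding classified_def using s
    by (intro exI[of _ "(x1, y1, z1)"] exI[of _ "(x2, y2, z2)"] conjI allI impI bexI[of _ family_ii]) simp_all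
qed

lemma classified_if_type_C_O:
  fixes a b c :: nat
  assumes gt: "a > 1" "b > 1" "c > 1" and p: "prime p" "p dvd a" "p dvd b"
    and s: "is_solution (a, b, c) s1" "is_solution (a, b, c) s2" "s1 \<noteq> s2"
    and t1: "type_C p (a, b, c) s1 \<or> type_O p (a, b, c) s1"
    and t2: "type_C p (a, b, c) s2 \<or> type_O p (a, b, c) s2"
    and np: "\<not> (\<exists>i j l. a = 2 ^ i \<and> b = 2 ^ j \<and> c = 2 ^ l)"
  shows "classified a b c"
proof -
  have *: "classified a b c" if s': "is_solution (a, b, c) s1" "is_solution (a, b, c) s2"
    and P: "tripled_pair (a, b, c) s1 s2" for s1 s2
  proof -
    obtain x1 y1 z1 where s1: "s1 = (x1, y1, z1)" by (cases s1)
    obtain x2 y2 z2 where s2: "s2 = (x2, y2, z2)" by (cases s2)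
    note s = s'[unfolded s1 s2]
    obtain D where Q: "x2 = 3 * x1" "y2 = 3 * y1" "\<And>r. prime r \<Longrightarrow> r dvd c \<Longrightarrow> r = 3"
      and D: "a ^ x1 = 2 * D \<and> b ^ y1 = D \<or> a ^ x1 = D \<and> b ^ y1 = 2 * D"
      using P unfolding s1 s2 tripled_pair_def prod.case by blast
    from D show ?thesis
    proof
      assume "a ^ x1 = 2 * D \<and> b ^ y1 = D"
      thus ?thesis using classified_if_tripled_pair[OF gt s Q(1,2) _ _ Q(3)] by blast
    next
      assume "a ^ x1 = D \<and> b ^ y1 = 2 * D"
      moreover have "is_solution (b, a, c) (y1, x1, z1)" "is_solution (b, a, c) (y2, x2, z2)"
        using s unfolding is_solution_swap[of b a] by blast+
      ultimately have "classified b a c"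
        using classified_if_tripled_pair[OF gt(2,1,3) _ _ Q(2,1) _ _ Q(3)] by blast
      thus ?thesis by (rule classified_swap)
    qed
  qed
  obtain x1 y1 z1 where s1: "s1 = (x1, y1, z1)" by (cases s1)
  obtain x2 y2 z2 where s2: "s2 = (x2, y2, z2)" by (cases s2)
  have "(\<exists>i j l. a = 2 ^ i \<and> b = 2 ^ j \<and> c = 2 ^ l) \<or>
    tripled_pair (a, b, c) s1 s2 \<or> tripled_pair (a, b, c) s2 s1"
    unfolding s1 s2
    by (rule tripled_pair_if_proportional[OF gt p]) (use s t1 t2 in \<open>auto simp: s1 s2\<close>)
  thus ?thesis using np *[OF s(1,2)] *[OF s(2,1)] by blast
qed

section \<open>Combining the types\<close>

lemma no_type_C_and_type_B:
  fixes a b c :: nat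
  assumes p: "prime p" "p dvd b" and gt: "a > 1" "b > 1" "c > 1"
    and 1: "is_solution (a, b, c) (x1, y1, z1)" "type_C p (a, b, c) (x1, y1, z1)"
    and 2: "is_solution (a, b, c) (x2, y2, z2)" "type_B p (a, b, c) (x2, y2, z2)"
  shows False
proof (rule no_type_C_and_type_A[OF p gt(2,1,3)])
  show "b ^ y1 + a ^ x1 = c ^ z1" "b ^ y2 + a ^ x2 = c ^ z2" "y1 > 0" "x1 > 0" "z1 > 0"
    using 1(1) 2(1) by (simp_all add: add.commute)
  show "type_C p (b, a, c) (y1, x1, z1)" "type_A p (b, a, c) (y2, x2, z2)"
    using 1(2) 2(2) unfolding type_swap[where b = b and a = a] by blast+
qed

lemma classified_if_type_C:
  fixes a b c :: nat
  assumes gt: "a > 1" "b > 1" "c > 1" and p: "prime p" "p dvd a" "p dvd b"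
    and s: "is_solution (a, b, c) s1" "is_solution (a, b, c) s2" "s1 \<noteq> s2"
    and t1: "type_C p (a, b, c) s1"
    and np: "\<not> (\<exists>i j l. a = 2 ^ i \<and> b = 2 ^ j \<and> c = 2 ^ l)"
  shows "classified a b c"
proof -
  obtain x1 y1 z1 where s1: "s1 = (x1, y1, z1)" by (cases s1)
  obtain x2 y2 z2 where s2: "s2 = (x2, y2, z2)" by (cases s2)
  have sol: "a ^ x1 + b ^ y1 = c ^ z1" "x1 > 0" "y1 > 0" "z1 > 0" "a ^ x2 + b ^ y2 = c ^ z2"
    using s by (simp_all add: s1 s2)
  have "\<not> type_A p (a, b, c) s2"
    using no_type_C_and_type_A[OF p(1,2) gt sol(1) _ sol(2-4) sol(5)] t1 unfolding s1 s2 by blast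
  moreover have "\<not> type_B p (a, b, c) s2"
    using no_type_C_and_type_B[OF p(1,3) gt] s t1 unfolding s1 s2 by blast
  ultimately have "type_C p (a, b, c) s2 \<or> type_O p (a, b, c) s2"
    using solution_type_cases[OF p(1), of a b c x2 y2 z2] sol gt unfolding s2 by auto
  thus ?thesis using classified_if_type_C_O[OF gt p s _ _ np] t1 by blast
qed

text \<open>For powers of 2, equal valuations mean equal numbers, so type O would make both summands
  equal to their sum. This supplies for \<open>S_o\<close> the exclusion that is part of the
  definition of \<open>S_c\<close>.\<close>

lemma type_O_not_pow2:
  fixes a b c :: nat
  assumes gt: "a > 1" "b > 1" "c > 1" and p: "prime p" "p dvd a"
    and s: "is_solution (a, b, c) s" "type_O p (a, b, c) s"
  shows "\<not> (\<exists>i j l. a = 2 ^ i \<and> b = 2 ^ j \<and> c = 2 ^ l)"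
proof
  assume "\<exists>i j l. a = 2 ^ i \<and> b = 2 ^ j \<and> c = 2 ^ l"
  then obtain i j l where e: "a = 2 ^ i" "b = 2 ^ j" "c = 2 ^ l" by blast
  have "p dvd 2" using p e(1) prime_dvd_power by blast
  hence p2: "p = 2" using p(1) by (metis primes_dvd_imp_eq two_is_prime_nat)
  obtain x y z where xyz: "s = (x, y, z)" by (cases s)
  have "i * x = j * y" "j * y = l * z" using s(2) unfolding xyz p2 e by simp_all
  hence "b ^ y = a ^ x" "c ^ z = a ^ x" by (simp_all add: e power_mult[symmetric])
  hence "a ^ x = 0" using s(1) by (simp add: xyz)
  thus False using gt by simp
qed

lemma classified_if_type_O:
  fixes a b c :: nat
  assumes gt: "a > 1" "b > 1" "c > 1" and p: "prime p" "p dvd a" "p dvd b" "p dvd c"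
    and s: "is_solution (a, b, c) s1" "is_solution (a, b, c) s2" "s1 \<noteq> s2"
    and t1: "type_O p (a, b, c) s1"
  shows "classified a b c"
proof -
  obtain x2 y2 z2 where s2: "s2 = (x2, y2, z2)" by (cases s2)
  have "type_A p (a, b, c) s2 \<or> type_B p (a, b, c) s2 \<or> type_C p (a, b, c) s2 \<or> type_O p (a, b, c) s2"
    using solution_type_cases[OF p(1), of a b c x2 y2 z2] s(2) gt unfolding s2 by auto
  thus ?thesis
    using classified_if_type_A_O[OF gt p s] classified_if_type_B_O[OF gt p s]
      classified_if_type_C_O[OF gt p(1-3) s] type_O_not_pow2[OF gt p(1,2) s(1) t1] t1 by blast
qed

theorem theorem4p3:
  fixes a b c :: nat
  assumes "a > 1" and "b > 1" and "c > 1" and "gcd a b > 1"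
    and "(a, b, c) \<in> S_c \<union> S_o \<union> S_aa \<union> S_bb"
  shows "num_solutions a b c = 2 \<and>
    (\<exists>x1 y1 z1 x2 y2 z2.
       is_solution (a, b, c) (x1, y1, z1) \<and> is_solution (a, b, c) (x2, y2, z2) \<and>
       (x1, y1, z1) \<noteq> (x2, y2, z2) \<and>
       (\<exists>F\<in>{family_i, family_ii, family_iii, family_iv}.
          in_family F ((a, b, c), (x1, y1, z1), (x2, y2, z2))))"
proof -
  note gt = assms(1-3)
  have Q: "prime p" "p dvd a" "p dvd b" "p dvd c" if "p \<in> common_primes (a, b, c)" for p
    using that by (auto simp: common_primes_def)
  have other: "\<exists>s'. is_solution (a, b, c) s' \<and> s \<noteq> s'"
    if "num_solutions a b c > 1" "is_solution (a, b, c) s" for s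
    using inequivalent_solution_if_num_solutions_gt_1[OF that] by blast
  have "classified a b c"
    using assms(5)
  proof (elim UnE)
    assume "(a, b, c) \<in> S_c"
    then obtain s p where s: "num_solutions a b c > 1" "is_solution (a, b, c) s"
      "\<not> (\<exists>i j k. a = 2 ^ i \<and> b = 2 ^ j \<and> c = 2 ^ k)"
      and p: "p \<in> common_primes (a, b, c)" "type_C p (a, b, c) s"
      unfolding S_c_def by blast
    obtain s' where "is_solution (a, b, c) s'" "s \<noteq> s'" using other[OF s(1,2)] by blast
    thus ?thesis using classified_if_type_C[OF gt Q(1-3)[OF p(1)] s(2) _ _ p(2) s(3)] by blast
  next
    assume "(a, b, c) \<in> S_o"
    then obtain s p where s: "num_solutions a b c > 1" "is_solution (a, b, c) s"
      and p: "p \<in> common_primes (a, b, c)" "type_O p (a, b, c) s"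
      unfolding S_o_def by blast
    obtain s' where "is_solution (a, b, c) s'" "s \<noteq> s'" using other[OF s(1,2)] by blast
    thus ?thesis using classified_if_type_O[OF gt Q[OF p(1)] s(2) _ _ p(2)] by blast
  next
    assume "(a, b, c) \<in> S_aa"
    then obtain s s' p where "is_solution (a, b, c) s" "is_solution (a, b, c) s'" "s \<noteq> s'"
      and p: "p \<in> common_primes (a, b, c)" "type_A p (a, b, c) s" "type_A p (a, b, c) s'"
      unfolding S_aa_def by blast
    thus ?thesis using classified_if_type_A_O[OF gt Q[OF p(1)]] by blast
  next
    assume "(a, b, c) \<in> S_bb"
    then obtain s s' p where "is_solution (a, b, c) s" "is_solution (a, b, c) s'" "s \<noteq> s'"
      and p: "p \<in> common_primes (a, b, c)" "type_B p (a, b, c) s" "type_B p (a, b, c) s'"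
      unfolding S_bb_def by blast
    thus ?thesis using classified_if_type_B_O[OF gt Q[OF p(1)]] by blast
  qed
  moreover from this obtain s1 s2 F where "is_solution (a, b, c) s1" "is_solution (a, b, c) s2"
    "summands (a, b, c) s1 \<noteq> summands (a, b, c) s2"
    "F \<in> {family_i, family_ii, family_iii, family_iv}" "in_family F ((a, b, c), s1, s2)"
    unfolding classified_def by blast
  ultimately show ?thesis using num_solutions_classified by (metis prod_cases3)
qed

end
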